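(* (1) Assume $\mathsf{ZF} + \mathsf{AD}$. Suppose $X \subseteq [\omega_1]^{<\omega_1}$ and $\omega_1$ injects into $X$. Then there is a sequence $\langle E_\alpha : \alpha < \omega_1\rangle$ of weakly smooth equivalence relations on $\mathbb{R}$ such that $X$ is in bijection with $\bigsqcup_{\alpha < \omega_1} \mathbb{R}/E_\alpha$. (2) Assume $\mathsf{ZF} + \mathsf{AD}^+ + V = L(\mathscr{P}(\mathbb{R}))$. Suppose $X \subseteq [\omega_1]^{<\omega_1}$ and $\mathbb{R} \sqcup \omega_1$ injects into $X$. Then there is a sequence $\langle E_\alpha : \alpha < \omega_1\rangle$ of smooth equivalence relations on $\mathbb{R}$ such that $X$ is in bijection with $\bigsqcup_{\alpha < \omega_1} \mathbb{R}/E_\alpha$. (3) Consequently, assuming $\mathsf{ZF} + \mathsf{AD}^+ + V = L(\mathscr{P}(\mathbb{R}))$, a set $X \subseteq [\omega_1]^{<\omega_1}$ admits a sequence $\langle E_\alpha : \alpha < \omega_1\rangle$ of smooth equivalence relations on $\mathbb{R}$ with $X$ in bijection with $\bigsqcup_{\alpha<\omega_1}\mathbb{R}/E_\alpha$ if and only if $\mathbb{R} \sqcup \omega_1$ injects into $X$.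
   Context: $[\omega_1]^{<\omega_1}$ denotes the set of strictly increasing functions from a countable ordinal into $\omega_1$ (equivalently, countable subsets of $\omega_1$). An equivalence relation $E$ on $\mathbb{R}$ is smooth if $\mathbb{R}/E$ is in bijection with $\mathbb{R}$, and weakly smooth if $\mathbb{R}/E$ injects into $\mathbb{R}$. $\bigsqcup_{\alpha<\omega_1} \mathbb{R}/E_\alpha$ denotes the formal disjoint union $\{(\alpha, c) : \alpha < \omega_1,\ c \in \mathbb{R}/E_\alpha\}$, and $\mathbb{R}\sqcup\omega_1$ the formal disjoint union of $\mathbb{R}$ and $\omega_1$. $\mathsf{AD}^+$ is the conjunction of: (1) $\mathsf{DC}_{\mathbb{R}}$; (2) every $A \subseteq \mathbb{R}$ has an $\infty$-Borel code, i.e. there are a set of ordinals $S$ and a formula $\varphi$ with $A = \{x \in \mathbb{R} : L[S,x] \models \varphi(S,x)\}$; (3) for every $\lambda < \Theta$ (the least ordinal which is not a surjective image of $\mathbb{R}$), every $A \subseteq \mathbb{R}$ and every continuous $\pi : {}^\omega\lambda \to \mathbb{R}$, the set $\pi^{-1}[A]$ is determined. *)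

theory Defs
  imports Main
begin

text \<open>
  Isabelle/HOL proves the axiom of choice, which contradicts AD. Hence ``assume ZF + AD'' is
  rendered semantically: the results are about an arbitrary first-order structure
  \<open>('v, mem)\<close> satisfying the ZF axioms, with Separation and Replacement as schemas over
  first-order formulas. All set-theoretic notions below are evaluated inside that structure:
  sets, functions, strategies, sequences etc. are elements of \<open>'v\<close>. By Goedel's completeness
  theorem, validity in all such structures is provability in the theory.
\<close>

datatype fm = Mem nat nat | Eq nat nat | Neg fm | And fm fm | All nat fm

primrec fv :: "fm \<Rightarrow> nat set" where
  "fv (Mem i j) = {i, j}"
| "fv (Eq i j) = {i, j}"
| "fv (Neg p) = fv p"
| "fv (And p q) = fv p \<union> fv q"
| "fv (All i p) = fv p - {i}"

primrec sat :: "'v set \<Rightarrow> ('v \<Rightarrow> 'v \<Rightarrow> bool) \<Rightarrow> (nat \<Rightarrow> 'v) \<Rightarrow> fm \<Rightarrow> bool" where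
  "sat D m s (Mem i j) \<longleftrightarrow> m (s i) (s j)"
| "sat D m s (Eq i j) \<longleftrightarrow> s i = s j"
| "sat D m s (Neg p) \<longleftrightarrow> \<not> sat D m s p"
| "sat D m s (And p q) \<longleftrightarrow> sat D m s p \<and> sat D m s q"
| "sat D m s (All i p) \<longleftrightarrow> (\<forall>x\<in>D. sat D m (s(i := x)) p)"

locale eps_structure =
  fixes mem :: "'v \<Rightarrow> 'v \<Rightarrow> bool" (infix \<open>\<epsilon>\<close> 50)
begin

definition extensionality :: bool where
  "extensionality \<longleftrightarrow> (\<forall>a b. (\<forall>x. x \<epsilon> a \<longleftrightarrow> x \<epsilon> b) \<longrightarrow> a = b)"

definition foundation :: bool where
  "foundation \<longleftrightarrow> (\<forall>a. (\<exists>x. x \<epsilon> a) \<longrightarrow> (\<exists>x. x \<epsilon> a \<and> \<not> (\<exists>y. y \<epsilon> x \<and> y \<epsilon> a)))"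

definition pairing :: bool where
  "pairing \<longleftrightarrow> (\<forall>a b. \<exists>c. \<forall>x. x \<epsilon> c \<longleftrightarrow> x = a \<or> x = b)"

definition union_axiom :: bool where
  "union_axiom \<longleftrightarrow> (\<forall>a. \<exists>u. \<forall>x. x \<epsilon> u \<longleftrightarrow> (\<exists>y. y \<epsilon> a \<and> x \<epsilon> y))"

definition power_set_axiom :: bool where
  "power_set_axiom \<longleftrightarrow> (\<forall>a. \<exists>p. \<forall>x. x \<epsilon> p \<longleftrightarrow> (\<forall>y. y \<epsilon> x \<longrightarrow> y \<epsilon> a))"

definition infinity :: bool where
  "infinity \<longleftrightarrow> (\<exists>w. (\<exists>z. z \<epsilon> w \<and> (\<forall>u. \<not> u \<epsilon> z)) \<and>
     (\<forall>x. x \<epsilon> w \<longrightarrow> (\<exists>y. y \<epsilon> w \<and> (\<forall>u. u \<epsilon> y \<longleftrightarrow> u \<epsilon> x \<or> u = x))))"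

definition separation :: bool where
  "separation \<longleftrightarrow> (\<forall>p s a. \<exists>b. \<forall>x. x \<epsilon> b \<longleftrightarrow> x \<epsilon> a \<and> sat UNIV mem (s(0 := x)) p)"

definition replacement :: bool where
  "replacement \<longleftrightarrow> (\<forall>p s a.
     (\<forall>x y z. x \<epsilon> a \<longrightarrow> sat UNIV mem (s(0 := x, 1 := y)) p \<longrightarrow>
        sat UNIV mem (s(0 := x, 1 := z)) p \<longrightarrow> y = z) \<longrightarrow>
     (\<exists>b. \<forall>y. y \<epsilon> b \<longleftrightarrow> (\<exists>x. x \<epsilon> a \<and> sat UNIV mem (s(0 := x, 1 := y)) p)))"

definition ZF :: bool where
  "ZF \<longleftrightarrow> extensionality \<and> foundation \<and> pairing \<and> union_axiom \<and> power_set_axiom \<and>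
     infinity \<and> separation \<and> replacement"

text \<open>The element with the given extension; used only where ZF provides such an element.\<close>
definition set_of :: "('v \<Rightarrow> bool) \<Rightarrow> 'v" (binder \<open>SET \<close> 10) where
  "set_of P = (THE a. \<forall>x. x \<epsilon> a \<longleftrightarrow> P x)"

definition subset :: "'v \<Rightarrow> 'v \<Rightarrow> bool" where
  "subset a b \<longleftrightarrow> (\<forall>x. x \<epsilon> a \<longrightarrow> x \<epsilon> b)"

definition empty :: 'v where
  "empty = (SET x. False)"

definition upair :: "'v \<Rightarrow> 'v \<Rightarrow> 'v" where
  "upair a b = (SET x. x = a \<or> x = b)"

definition opair :: "'v \<Rightarrow> 'v \<Rightarrow> 'v" where
  "opair a b = upair (upair a a) (upair a b)"

definition suc :: "'v \<Rightarrow> 'v" where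
  "suc a = (SET x. x \<epsilon> a \<or> x = a)"

definition power_set :: "'v \<Rightarrow> 'v" where
  "power_set a = (SET x. subset x a)"

definition fun_on :: "'v \<Rightarrow> 'v \<Rightarrow> bool" where
  "fun_on f A \<longleftrightarrow> (\<forall>p. p \<epsilon> f \<longrightarrow> (\<exists>x y. x \<epsilon> A \<and> p = opair x y)) \<and>
     (\<forall>x. x \<epsilon> A \<longrightarrow> (\<exists>!y. opair x y \<epsilon> f))"

definition app :: "'v \<Rightarrow> 'v \<Rightarrow> 'v" where
  "app f x = (THE y. opair x y \<epsilon> f)"

definition maps :: "'v \<Rightarrow> 'v \<Rightarrow> 'v \<Rightarrow> bool" where
  "maps f A B \<longleftrightarrow> fun_on f A \<and> (\<forall>x. x \<epsilon> A \<longrightarrow> app f x \<epsilon> B)"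

definition fun_space :: "'v \<Rightarrow> 'v \<Rightarrow> 'v" where
  "fun_space A B = (SET f. maps f A B)"

definition restr :: "'v \<Rightarrow> 'v \<Rightarrow> 'v" where
  "restr f A = (SET p. p \<epsilon> f \<and> (\<exists>x y. x \<epsilon> A \<and> p = opair x y))"

definition inj_from_to :: "'v \<Rightarrow> 'v \<Rightarrow> 'v \<Rightarrow> bool" where
  "inj_from_to f A B \<longleftrightarrow> maps f A B \<and>
     (\<forall>x y. x \<epsilon> A \<longrightarrow> y \<epsilon> A \<longrightarrow> app f x = app f y \<longrightarrow> x = y)"

definition surj_from_to :: "'v \<Rightarrow> 'v \<Rightarrow> 'v \<Rightarrow> bool" where
  "surj_from_to f A B \<longleftrightarrow> maps f A B \<and> (\<forall>y. y \<epsilon> B \<longrightarrow> (\<exists>x. x \<epsilon> A \<and> app f x = y))"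

definition injects :: "'v \<Rightarrow> 'v \<Rightarrow> bool" where
  "injects A B \<longleftrightarrow> (\<exists>f. inj_from_to f A B)"

definition in_bijection :: "'v \<Rightarrow> 'v \<Rightarrow> bool" where
  "in_bijection A B \<longleftrightarrow> (\<exists>f. inj_from_to f A B \<and> surj_from_to f A B)"

definition transitive :: "'v \<Rightarrow> bool" where
  "transitive a \<longleftrightarrow> (\<forall>x. x \<epsilon> a \<longrightarrow> subset x a)"

definition ordinal :: "'v \<Rightarrow> bool" where
  "ordinal a \<longleftrightarrow> transitive a \<and> (\<forall>x. x \<epsilon> a \<longrightarrow> transitive x)"

definition zero_or_suc :: "'v \<Rightarrow> bool" where
  "zero_or_suc a \<longleftrightarrow> a = empty \<or> (\<exists>b. a = suc b)"

definition limit_ordinal :: "'v \<Rightarrow> bool" where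
  "limit_ordinal a \<longleftrightarrow> ordinal a \<and> \<not> zero_or_suc a"

definition omega :: 'v where
  "omega = (SET n. ordinal n \<and> zero_or_suc n \<and> (\<forall>k. k \<epsilon> n \<longrightarrow> zero_or_suc k))"

definition omega1 :: 'v where
  "omega1 = (SET a. ordinal a \<and> injects a omega)"

definition reals :: 'v where
  "reals = fun_space omega omega"

text \<open>For \<open>n\<close> in \<open>omega\<close>; \<open>e\<close> alternates along \<open>0, \<dots>, n\<close> starting with \<open>0\<close> inside \<open>e\<close>.\<close>
definition even_nat :: "'v \<Rightarrow> bool" where
  "even_nat n \<longleftrightarrow> (\<exists>e. empty \<epsilon> e \<and> (\<forall>k. k \<epsilon> n \<longrightarrow> (suc k \<epsilon> e \<longleftrightarrow> \<not> k \<epsilon> e)) \<and> n \<epsilon> e)"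

definition even_positions :: "'v \<Rightarrow> 'v" where
  "even_positions A = (SET s. \<exists>n. n \<epsilon> omega \<and> even_nat n \<and> maps s n A)"

definition odd_positions :: "'v \<Rightarrow> 'v" where
  "odd_positions A = (SET s. \<exists>n. n \<epsilon> omega \<and> \<not> even_nat n \<and> maps s n A)"

definition I_wins :: "'v \<Rightarrow> 'v \<Rightarrow> bool" where
  "I_wins A Z \<longleftrightarrow> (\<exists>\<sigma>. maps \<sigma> (even_positions A) A \<and>
     (\<forall>f. maps f omega A \<longrightarrow>
        (\<forall>n. n \<epsilon> omega \<longrightarrow> even_nat n \<longrightarrow> app f n = app \<sigma> (restr f n)) \<longrightarrow> f \<epsilon> Z))"

definition II_wins :: "'v \<Rightarrow> 'v \<Rightarrow> bool" where
  "II_wins A Z \<longleftrightarrow> (\<exists>\<tau>. maps \<tau> (odd_positions A) A \<and>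
     (\<forall>f. maps f omega A \<longrightarrow>
        (\<forall>n. n \<epsilon> omega \<longrightarrow> \<not> even_nat n \<longrightarrow> app f n = app \<tau> (restr f n)) \<longrightarrow> \<not> f \<epsilon> Z))"

text \<open>The game of length omega with moves in \<open>A\<close> and payoff set \<open>Z\<close> for player I.\<close>
definition determined :: "'v \<Rightarrow> 'v \<Rightarrow> bool" where
  "determined A Z \<longleftrightarrow> I_wins A Z \<or> II_wins A Z"

definition AD :: bool where
  "AD \<longleftrightarrow> (\<forall>Z. subset Z reals \<longrightarrow> determined omega Z)"

text \<open>
  The inductive closure conditions of the family of all pairs \<open>(n, R)\<close> such that \<open>R\<close> is an
  \<open>n\<close>-ary relation first-order definable without parameters over
  \<open>(A, \<in>, P \<inter> A, Q \<inter> A)\<close>: atomic formulas, negation, conjunction, and existential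
  quantification over the last variable (cf. Kunen, Set Theory, Chapter VI).
\<close>
definition definability_closed :: "'v \<Rightarrow> 'v \<Rightarrow> 'v \<Rightarrow> 'v \<Rightarrow> bool" where
  "definability_closed P Q A D \<longleftrightarrow>
     (\<forall>n i j. n \<epsilon> omega \<longrightarrow> i \<epsilon> n \<longrightarrow> j \<epsilon> n \<longrightarrow>
        opair n (SET s. maps s n A \<and> app s i \<epsilon> app s j) \<epsilon> D \<and>
        opair n (SET s. maps s n A \<and> app s i = app s j) \<epsilon> D \<and>
        opair n (SET s. maps s n A \<and> app s i \<epsilon> P) \<epsilon> D \<and>
        opair n (SET s. maps s n A \<and> app s i \<epsilon> Q) \<epsilon> D) \<and>
     (\<forall>n R. n \<epsilon> omega \<longrightarrow> opair n R \<epsilon> D \<longrightarrow>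
        opair n (SET s. maps s n A \<and> \<not> s \<epsilon> R) \<epsilon> D) \<and>
     (\<forall>n R R'. n \<epsilon> omega \<longrightarrow> opair n R \<epsilon> D \<longrightarrow> opair n R' \<epsilon> D \<longrightarrow>
        opair n (SET s. s \<epsilon> R \<and> s \<epsilon> R') \<epsilon> D) \<and>
     (\<forall>n R. n \<epsilon> omega \<longrightarrow> opair (suc n) R \<epsilon> D \<longrightarrow>
        opair n (SET s. maps s n A \<and> (\<exists>t. t \<epsilon> R \<and> restr t n = s)) \<epsilon> D)"

definition definable_relation :: "'v \<Rightarrow> 'v \<Rightarrow> 'v \<Rightarrow> 'v \<Rightarrow> 'v \<Rightarrow> bool" where
  "definable_relation P Q A n R \<longleftrightarrow> (\<forall>D. definability_closed P Q A D \<longrightarrow> opair n R \<epsilon> D)"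

text \<open>The set of subsets of \<open>A\<close> definable with parameters over \<open>(A, \<in>, P \<inter> A, Q \<inter> A)\<close>.\<close>
definition Def :: "'v \<Rightarrow> 'v \<Rightarrow> 'v \<Rightarrow> 'v" where
  "Def P Q A = (SET X. \<exists>n s R. n \<epsilon> omega \<and> maps s n A \<and> definable_relation P Q A (suc n) R \<and>
     X = (SET a. a \<epsilon> A \<and> (SET p. p \<epsilon> s \<or> p = opair n a) \<epsilon> R))"

text \<open>\<open>F\<close> lists the levels up to \<open>a\<close> of the hierarchy that starts with \<open>B\<close> and iterates \<open>Def P Q\<close>.\<close>
definition constructible_levels :: "'v \<Rightarrow> 'v \<Rightarrow> 'v \<Rightarrow> 'v \<Rightarrow> 'v \<Rightarrow> bool" where
  "constructible_levels B P Q a F \<longleftrightarrow> ordinal a \<and> fun_on F (suc a) \<and> app F empty = B \<and>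
     (\<forall>b. b \<epsilon> a \<longrightarrow> app F (suc b) = Def P Q (app F b)) \<and>
     (\<forall>b. b \<epsilon> suc a \<longrightarrow> limit_ordinal b \<longrightarrow>
        app F b = (SET x. \<exists>c. c \<epsilon> b \<and> x \<epsilon> app F c))"

definition constructible :: "'v \<Rightarrow> 'v \<Rightarrow> 'v \<Rightarrow> 'v \<Rightarrow> bool" where
  "constructible B P Q y \<longleftrightarrow> (\<exists>a F. constructible_levels B P Q a F \<and> y \<epsilon> app F a)"

text \<open>The class \<open>L[S, x]\<close>.\<close>
definition L_rel :: "'v \<Rightarrow> 'v \<Rightarrow> 'v set" where
  "L_rel S x = {y. constructible empty S x y}"

text \<open>The transitive closure of \<open>{A}\<close>.\<close>
definition trcl_singleton :: "'v \<Rightarrow> 'v" where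
  "trcl_singleton A = (SET y. \<forall>T. transitive T \<longrightarrow> A \<epsilon> T \<longrightarrow> y \<epsilon> T)"

text \<open>The class \<open>L(A)\<close>; the empty predicates add nothing to definability.\<close>
definition L_over :: "'v \<Rightarrow> 'v set" where
  "L_over A = {y. constructible (trcl_singleton A) empty empty y}"

definition V_eq_L_power_reals :: bool where
  "V_eq_L_power_reals \<longleftrightarrow> L_over (power_set reals) = UNIV"

definition DC_reals :: bool where
  "DC_reals \<longleftrightarrow> (\<forall>R. (\<forall>x. x \<epsilon> reals \<longrightarrow> (\<exists>y. y \<epsilon> reals \<and> opair x y \<epsilon> R)) \<longrightarrow>
     (\<exists>f. maps f omega reals \<and> (\<forall>n. n \<epsilon> omega \<longrightarrow> opair (app f n) (app f (suc n)) \<epsilon> R)))"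

definition infinity_Borel_code :: "'v \<Rightarrow> fm \<Rightarrow> 'v \<Rightarrow> bool" where
  "infinity_Borel_code S p A \<longleftrightarrow> (\<forall>a. a \<epsilon> S \<longrightarrow> ordinal a) \<and> fv p \<subseteq> {0, 1} \<and>
     (\<forall>x. x \<epsilon> A \<longleftrightarrow> x \<epsilon> reals \<and> sat (L_rel S x) mem ((\<lambda>_. empty)(0 := S, 1 := x)) p)"

text \<open>Nonzero is required because \<open>0\<close>, too, is not a surjective image of the reals.\<close>
definition is_Theta :: "'v \<Rightarrow> bool" where
  "is_Theta t \<longleftrightarrow> ordinal t \<and> t \<noteq> empty \<and> \<not> (\<exists>f. surj_from_to f reals t) \<and>
     (\<forall>b. b \<epsilon> t \<longrightarrow> b \<noteq> empty \<longrightarrow> (\<exists>f. surj_from_to f reals b))"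

text \<open>Continuity for the products of the discrete topologies on \<open>l\<close> and on \<open>omega\<close>.\<close>
definition continuous_to_reals :: "'v \<Rightarrow> 'v \<Rightarrow> bool" where
  "continuous_to_reals l h \<longleftrightarrow> maps h (fun_space omega l) reals \<and>
     (\<forall>f n. maps f omega l \<longrightarrow> n \<epsilon> omega \<longrightarrow>
        (\<exists>m. m \<epsilon> omega \<and> (\<forall>g. maps g omega l \<longrightarrow> restr g m = restr f m \<longrightarrow>
           restr (app h g) n = restr (app h f) n)))"

definition ordinal_determinacy :: bool where
  "ordinal_determinacy \<longleftrightarrow> (\<forall>t l A h. is_Theta t \<longrightarrow> l \<epsilon> t \<longrightarrow> subset A reals \<longrightarrow>
     continuous_to_reals l h \<longrightarrow> determined l (SET f. maps f omega l \<and> app h f \<epsilon> A))"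

definition AD_plus :: bool where
  "AD_plus \<longleftrightarrow> DC_reals \<and>
     (\<forall>A. subset A reals \<longrightarrow> (\<exists>S p. infinity_Borel_code S p A)) \<and>
     ordinal_determinacy"

definition equivalence_on_reals :: "'v \<Rightarrow> bool" where
  "equivalence_on_reals E \<longleftrightarrow>
     (\<forall>p. p \<epsilon> E \<longrightarrow> (\<exists>x y. x \<epsilon> reals \<and> y \<epsilon> reals \<and> p = opair x y)) \<and>
     (\<forall>x. x \<epsilon> reals \<longrightarrow> opair x x \<epsilon> E) \<and>
     (\<forall>x y. opair x y \<epsilon> E \<longrightarrow> opair y x \<epsilon> E) \<and>
     (\<forall>x y z. opair x y \<epsilon> E \<longrightarrow> opair y z \<epsilon> E \<longrightarrow> opair x z \<epsilon> E)"

definition reals_quotient :: "'v \<Rightarrow> 'v" where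
  "reals_quotient E = (SET c. \<exists>x. x \<epsilon> reals \<and> c = (SET y. opair x y \<epsilon> E))"

definition smooth :: "'v \<Rightarrow> bool" where
  "smooth E \<longleftrightarrow> equivalence_on_reals E \<and> in_bijection (reals_quotient E) reals"

definition weakly_smooth :: "'v \<Rightarrow> bool" where
  "weakly_smooth E \<longleftrightarrow> equivalence_on_reals E \<and> injects (reals_quotient E) reals"

text \<open>For a function \<open>E\<close> on \<open>omega1\<close>, the disjoint union of the quotients of the reals by \<open>E(a)\<close>.\<close>
definition quotients_disjoint_union :: "'v \<Rightarrow> 'v" where
  "quotients_disjoint_union E =
     (SET p. \<exists>a c. a \<epsilon> omega1 \<and> c \<epsilon> reals_quotient (app E a) \<and> p = opair a c)"

definition disjoint_sum :: "'v \<Rightarrow> 'v \<Rightarrow> 'v" where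
  "disjoint_sum A B =
     (SET p. (\<exists>x. x \<epsilon> A \<and> p = opair empty x) \<or> (\<exists>y. y \<epsilon> B \<and> p = opair (suc empty) y))"

definition countable_increasing :: 'v where
  "countable_increasing = (SET f. \<exists>a. a \<epsilon> omega1 \<and> maps f a omega1 \<and>
     (\<forall>b c. b \<epsilon> c \<longrightarrow> c \<epsilon> a \<longrightarrow> app f b \<epsilon> app f c))"

end

end

theory Submission imports Defs begin

text \<open>
  Determinacy enters only through countable choice for sets of reals, which follows from AD by a
  simple game and from AD+ because of \<open>DC\<close> for the reals. Choice makes \<open>omega1\<close> regular, so every
  element of \<open>X\<close> is a subset of \<open>d \<times> d\<close> for some countable ordinal \<open>d\<close>. Such sets are coded by
  reals (a real codes a wellorder of a subset of the natural numbers and a transported copy of the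
  set), and those below a fixed \<open>d\<close> inject into the reals.

  Hence \<open>X\<close> splits into pieces \<open>X\<^sub>a\<close> (\<open>a < omega1\<close>) that inject into the reals. An injection \<open>j\<close> of
  \<open>omega1\<close> into \<open>X\<close> lets us arrange \<open>j a \<in> X\<^sub>a\<close>, so that the coding becomes a total surjection of
  the reals onto \<open>X\<^sub>a\<close>, uniformly in \<open>a\<close>; its kernel is \<open>E\<^sub>a\<close>. If the reals also inject into \<open>X\<close>,
  distribute this copy over the pieces: send the pair \<open>(x, y)\<close> to the ordinal coded by \<open>y\<close>. Every
  piece then contains a copy of the reals, and Cantor-Bernstein applies. Conversely \<open>a \<mapsto> [0]\<close>
  injects \<open>omega1\<close> into any disjoint union of quotients.
\<close>

section \<open>First-order definability\<close>

named_theorems definability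

lemma finite_fv: "finite (fv p)"
  by (induction p) auto

lemma sat_cong: "(\<And>i. i \<in> fv p \<Longrightarrow> s i = t i) \<Longrightarrow> sat D m s p \<longleftrightarrow> sat D m t p"
proof (induction p arbitrary: s t)
  case (And p q)
  have "sat D m s p \<longleftrightarrow> sat D m t p" by (rule And.IH) (simp add: And.prems)
  moreover have "sat D m s q \<longleftrightarrow> sat D m t q" by (rule And.IH) (simp add: And.prems)
  ultimately show ?case by simp
next
  case (All i p)
  have "sat D m (s(i := x)) p \<longleftrightarrow> sat D m (t(i := x)) p" for x
    by (rule All.IH) (use All.prems in auto)
  then show ?case by simp
next
  case (Neg p)
  have "sat D m s p \<longleftrightarrow> sat D m t p" by (rule Neg.IH) (simp add: Neg.prems)
  then show ?case by simp
qed simp_all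

lemma ex_sat_rename: "\<exists>q. \<forall>s. sat D m s q \<longleftrightarrow> sat D m (\<lambda>n. s (\<rho> n)) p"
proof (induction p arbitrary: \<rho>)
  case (Mem i j) show ?case by (rule exI[of _ "Mem (\<rho> i) (\<rho> j)"]) simp
next
  case (Eq i j) show ?case by (rule exI[of _ "Eq (\<rho> i) (\<rho> j)"]) simp
next
  case (Neg p)
  then obtain q where "\<forall>s. sat D m s q \<longleftrightarrow> sat D m (\<lambda>n. s (\<rho> n)) p" by blast
  then show ?case by (intro exI[of _ "Neg q"]) simp
next
  case (And p p')
  obtain q where "\<forall>s. sat D m s q \<longleftrightarrow> sat D m (\<lambda>n. s (\<rho> n)) p" using And by blast
  moreover obtain q' where "\<forall>s. sat D m s q' \<longleftrightarrow> sat D m (\<lambda>n. s (\<rho> n)) p'" using And by blast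
  ultimately show ?case by (intro exI[of _ "And q q'"]) simp
next
  case (All i p)
  obtain j where j: "j \<notin> \<rho> ` fv p"
    using ex_new_if_finite[OF infinite_UNIV_nat] finite_fv by blast
  obtain q where q: "\<forall>s. sat D m s q \<longleftrightarrow> sat D m (\<lambda>n. s ((\<rho>(i := j)) n)) p"
    using All by blast
  have "sat D m (s(j := x)) q \<longleftrightarrow> sat D m ((\<lambda>n. s (\<rho> n))(i := x)) p" for s x
    unfolding q[rule_format] by (rule sat_cong) (use j in auto)
  then show ?case by (intro exI[of _ "All j q"]) simp
qed

lemma ex_sat_all: "\<exists>q. \<forall>s. sat UNIV m s q \<longleftrightarrow> (\<forall>x. sat UNIV m (case_nat x s) p)"
proof -
  obtain q where q: "\<And>s. sat UNIV m s q \<longleftrightarrow> sat UNIV m (\<lambda>n. s (n - 1)) (All 0 p)"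
    using ex_sat_rename[of UNIV m "\<lambda>n. n - 1" "All 0 p"] by blast
  have "(\<lambda>n. s (n - 1))(0 := x) = case_nat x s" for s and x :: 'a
    by (auto simp: fun_eq_iff split: nat.split)
  then have "\<forall>s. sat UNIV m s q \<longleftrightarrow> (\<forall>x. sat UNIV m (case_nat x s) p)"
    unfolding q by simp
  then show ?thesis by blast
qed

definition interleave :: "(nat \<Rightarrow> 'a) \<Rightarrow> (nat \<Rightarrow> 'a) \<Rightarrow> nat \<Rightarrow> 'a" where
  "interleave s r n = (if even n then s (n div 2) else r (n div 2))"

locale zf_model = eps_structure +
  assumes ZF: ZF
begin

text \<open>
  The predicates and functions on assignments that are first-order definable with parameters.
  The assignment \<open>s\<close> holds the variables, \<open>r\<close> the parameters; passing under a binder shifts the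
  variables, de Bruijn style.
\<close>

definition definable_pred :: "((nat \<Rightarrow> 'a) \<Rightarrow> bool) \<Rightarrow> bool" where
  "definable_pred P \<longleftrightarrow> (\<exists>p r. \<forall>s. P s \<longleftrightarrow> sat UNIV mem (interleave s r) p)"

definition definable_fun :: "((nat \<Rightarrow> 'a) \<Rightarrow> 'a) \<Rightarrow> bool" where
  "definable_fun t \<longleftrightarrow> definable_pred (\<lambda>s. s 0 = t (\<lambda>n. s (Suc n)))"

abbreviation class_pred :: "('a \<Rightarrow> bool) \<Rightarrow> bool" where
  "class_pred P \<equiv> definable_pred (\<lambda>s. P (s 0))"

abbreviation class_rel :: "('a \<Rightarrow> 'a \<Rightarrow> bool) \<Rightarrow> bool" where
  "class_rel P \<equiv> definable_pred (\<lambda>s. P (s 0) (s (Suc 0)))"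

abbreviation class_fun :: "('a \<Rightarrow> 'a) \<Rightarrow> bool" where
  "class_fun t \<equiv> definable_fun (\<lambda>s. t (s 0))"

abbreviation class_fun2 :: "('a \<Rightarrow> 'a \<Rightarrow> 'a) \<Rightarrow> bool" where
  "class_fun2 t \<equiv> definable_fun (\<lambda>s. t (s 0) (s (Suc 0)))"

lemma definable_predE:
  assumes "definable_pred P"
  obtains p r where "\<And>s. P s \<longleftrightarrow> sat UNIV mem (interleave s r) p"
  using assms unfolding definable_pred_def by blast

lemma definable_pred_rename:
  assumes "definable_pred P" shows "definable_pred (\<lambda>s. P (\<lambda>n. s (\<rho> n)))"
proof -
  obtain p r where p: "\<And>s. P s \<longleftrightarrow> sat UNIV mem (interleave s r) p"
    using assms by (rule definable_predE) blast
  define f where "f n = (if even n then 2 * \<rho> (n div 2) else n)" for n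
  obtain q where q: "\<And>s. sat UNIV mem s q \<longleftrightarrow> sat UNIV mem (\<lambda>n. s (f n)) p"
    using ex_sat_rename by blast
  have "interleave (\<lambda>n. s (\<rho> n)) r = (\<lambda>n. interleave s r (f n))" for s
    by (auto simp: interleave_def fun_eq_iff f_def)
  then have "\<forall>s. P (\<lambda>n. s (\<rho> n)) \<longleftrightarrow> sat UNIV mem (interleave s r) q"
    by (simp add: p q)
  then show ?thesis unfolding definable_pred_def by blast
qed

lemma definable_pred_rename_tail:
  assumes "definable_pred (\<lambda>s. P (\<lambda>n. s (Suc n)) (s 0))"
  shows "definable_pred (\<lambda>s. P (\<lambda>n. s (\<rho> n)) (s 0))"
  using definable_pred_rename[OF assms, of "case_nat 0 \<rho>"] by simp

lemma definable_not [definability]: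
  assumes "definable_pred P" shows "definable_pred (\<lambda>s. \<not> P s)"
proof -
  obtain p r where "\<And>s. P s \<longleftrightarrow> sat UNIV mem (interleave s r) p"
    using assms by (rule definable_predE) blast
  then show ?thesis unfolding definable_pred_def by (intro exI[of _ "Neg p"] exI[of _ r]) simp
qed

lemma definable_conj [definability]:
  assumes "definable_pred P" "definable_pred Q" shows "definable_pred (\<lambda>s. P s \<and> Q s)"
proof -
  obtain p r where p: "\<And>s. P s \<longleftrightarrow> sat UNIV mem (interleave s r) p"
    using assms(1) by (rule definable_predE) blast
  obtain q r' where q: "\<And>s. Q s \<longleftrightarrow> sat UNIV mem (interleave s r') q"
    using assms(2) by (rule definable_predE) blast
  define f where "f n = (if even n then n else Suc (2 * (2 * (n div 2))))" for n :: nat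
  define g where "g n = (if even n then n else Suc (2 * Suc (2 * (n div 2))))" for n :: nat
  obtain p' where p': "\<And>s. sat UNIV mem s p' \<longleftrightarrow> sat UNIV mem (\<lambda>n. s (f n)) p"
    using ex_sat_rename by blast
  obtain q' where q': "\<And>s. sat UNIV mem s q' \<longleftrightarrow> sat UNIV mem (\<lambda>n. s (g n)) q"
    using ex_sat_rename by blast
  have "(\<lambda>n. interleave s (interleave r r') (f n)) = interleave s r"
    "(\<lambda>n. interleave s (interleave r r') (g n)) = interleave s r'" for s
    by (auto simp: interleave_def fun_eq_iff f_def g_def elim!: oddE)
  then have "\<forall>s. P s \<and> Q s \<longleftrightarrow> sat UNIV mem (interleave s (interleave r r')) (And p' q')"
    by (simp add: p q p' q')
  then show ?thesis unfolding definable_pred_def by blast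
qed

lemma definable_all [definability]:
  assumes "definable_pred (\<lambda>s. P (\<lambda>n. s (Suc n)) (s 0))"
  shows "definable_pred (\<lambda>s. \<forall>x. P s x)"
proof -
  obtain p r where p: "\<And>s. P (\<lambda>n. s (Suc n)) (s 0) \<longleftrightarrow> sat UNIV mem (interleave s r) p"
    using assms by (rule definable_predE) blast
  define f where "f n = (if n = 0 then 0 else if even n then n - 1 else Suc n)" for n :: nat
  obtain p' where p': "\<And>s. sat UNIV mem s p' \<longleftrightarrow> sat UNIV mem (\<lambda>n. s (f n)) p"
    using ex_sat_rename by blast
  obtain q where q: "\<And>s. sat UNIV mem s q \<longleftrightarrow> (\<forall>x. sat UNIV mem (case_nat x s) p')"
    using ex_sat_all by blast
  have "case_nat x (interleave s r) (f n) = interleave (case_nat x s) r n" for s x n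
  proof (cases "even n")
    case True
    then obtain m where "n = 2 * m" by blast
    then show ?thesis by (cases m) (auto simp: f_def interleave_def)
  qed (auto simp: f_def interleave_def elim: oddE)
  then have "sat UNIV mem (interleave s r) q \<longleftrightarrow> (\<forall>x. P s x)" for s
    unfolding q p' using p[of "case_nat _ s"] by simp
  then show ?thesis unfolding definable_pred_def by blast
qed

lemma definable_disj [definability]:
  "definable_pred P \<Longrightarrow> definable_pred Q \<Longrightarrow> definable_pred (\<lambda>s. P s \<or> Q s)"
  using definable_not[OF definable_conj[OF definable_not definable_not]] by simp

lemma definable_imp [definability]:
  "definable_pred P \<Longrightarrow> definable_pred Q \<Longrightarrow> definable_pred (\<lambda>s. P s \<longrightarrow> Q s)"
  using definable_not[OF definable_conj[OF _ definable_not]] by simp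

lemma definable_iff [definability]:
  "definable_pred P \<Longrightarrow> definable_pred Q \<Longrightarrow> definable_pred (\<lambda>s. P s \<longleftrightarrow> Q s)"
  using definable_conj[OF definable_imp definable_imp, of P Q Q P] by (simp add: iff_conv_conj_imp)

lemma definable_ex [definability]:
  assumes "definable_pred (\<lambda>s. P (\<lambda>n. s (Suc n)) (s 0))"
  shows "definable_pred (\<lambda>s. \<exists>x. P s x)"
  using definable_not[OF definable_all[OF definable_not[OF assms]]] by simp

lemma definable_pred_subst:
  assumes "definable_pred (\<lambda>s. P (\<lambda>n. s (Suc n)) (s 0))" "definable_fun t"
  shows "definable_pred (\<lambda>s. P s (t s))"
proof -
  have "definable_pred (\<lambda>s. \<exists>x. x = t s \<and> P s x)"
    using assms by (intro definable_ex definable_conj) (simp_all add: definable_fun_def)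
  then show ?thesis by simp
qed

lemma definable_fun_rename: "definable_fun t \<Longrightarrow> definable_fun (\<lambda>s. t (\<lambda>n. s (\<rho> n)))"
  unfolding definable_fun_def
  by (drule definable_pred_rename[where \<rho> = "case_nat 0 (\<lambda>n. Suc (\<rho> n))"]) simp

lemma definable_fun_rename_tail:
  assumes "definable_fun (\<lambda>s. t (\<lambda>n. s (Suc n)) (s 0))"
  shows "definable_fun (\<lambda>s. t (\<lambda>n. s (\<rho> n)) (s 0))"
  using definable_fun_rename[OF assms, of "case_nat 0 \<rho>"] by simp

lemma definable_pred_subst1: "class_pred P \<Longrightarrow> definable_fun t \<Longrightarrow> definable_pred (\<lambda>s. P (t s))"
  by (rule definable_pred_subst)

lemma definable_pred_subst2:
  assumes "class_rel P" "definable_fun t" "definable_fun u"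
  shows "definable_pred (\<lambda>s. P (t s) (u s))"
proof -
  have "definable_pred (\<lambda>s. P (t (\<lambda>n. s (Suc n))) (s 0))"
    by (rule definable_pred_subst[where P = "\<lambda>s x. P x (s 0)" and t = "\<lambda>s. t (\<lambda>n. s (Suc n))"])
       (use assms definable_fun_rename in auto)
  from definable_pred_subst[where P = "\<lambda>s x. P (t s) x", OF this assms(3)] show ?thesis .
qed

lemma definable_pred_subst3:
  assumes "definable_pred (\<lambda>s. P (s 0) (s (Suc 0)) (s (Suc (Suc 0))))"
    "definable_fun t" "definable_fun u" "definable_fun v"
  shows "definable_pred (\<lambda>s. P (t s) (u s) (v s))"
proof -
  have "definable_pred (\<lambda>s. P (t (\<lambda>n. s (Suc (Suc n)))) (s 0) (s (Suc 0)))"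
    by (rule definable_pred_subst[where P = "\<lambda>s x. P x (s 0) (s (Suc 0))",
          OF assms(1) definable_fun_rename[OF assms(2)]])
  then have "definable_pred (\<lambda>s. P (t (\<lambda>n. s (Suc n))) (u (\<lambda>n. s (Suc n))) (s 0))"
    by (rule definable_pred_subst[where P = "\<lambda>s x. P (t (\<lambda>n. s (Suc n))) x (s 0)",
          OF _ definable_fun_rename[OF assms(3)]])
  from definable_pred_subst[where P = "\<lambda>s x. P (t s) (u s) x", OF this assms(4)] show ?thesis .
qed

lemma definable_fun_subst1:
  assumes h: "class_fun h" and t: "definable_fun t" shows "definable_fun (\<lambda>s. h (t s))"
proof -
  have "definable_pred (\<lambda>s. s (Suc 0) = h (s 0))"
    using definable_pred_rename[OF h[unfolded definable_fun_def],
        of "case_nat (Suc 0) (case_nat 0 undefined)"] by simp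
  then have "definable_pred (\<lambda>s. s 0 = h (t (\<lambda>n. s (Suc n))))"
    by (rule definable_pred_subst[where P = "\<lambda>s x. s 0 = h x", OF _ definable_fun_rename[OF t]])
  then show ?thesis unfolding definable_fun_def .
qed

lemma definable_fun_subst2:
  assumes h: "class_fun2 h" and t: "definable_fun t" and u: "definable_fun u"
  shows "definable_fun (\<lambda>s. h (t s) (u s))"
proof -
  have "definable_pred (\<lambda>s. s (Suc (Suc 0)) = h (s (Suc 0)) (s 0))"
    using definable_pred_rename[OF h[unfolded definable_fun_def],
        of "case_nat (Suc (Suc 0)) (case_nat (Suc 0) (case_nat 0 undefined))"] by simp
  then have "definable_pred (\<lambda>s. s (Suc 0) = h (s 0) (u (\<lambda>n. s (Suc (Suc n)))))"
    by (rule definable_pred_subst[where P = "\<lambda>s x. s (Suc 0) = h (s 0) x",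
          OF _ definable_fun_rename[OF u]])
  then have "definable_pred (\<lambda>s. s 0 = h (t (\<lambda>n. s (Suc n))) (u (\<lambda>n. s (Suc n))))"
    by (rule definable_pred_subst[where P = "\<lambda>s x. s 0 = h x (u (\<lambda>n. s (Suc n)))",
          OF _ definable_fun_rename[OF t]])
  then show ?thesis unfolding definable_fun_def .
qed

lemma definable_mem [definability]:
  "definable_fun t \<Longrightarrow> definable_fun u \<Longrightarrow> definable_pred (\<lambda>s. t s \<epsilon> u s)"
  by (rule definable_pred_subst2)
     (auto simp: definable_pred_def interleave_def intro!: exI[of _ "Mem 0 2"])

lemma definable_eq [definability]:
  "definable_fun t \<Longrightarrow> definable_fun u \<Longrightarrow> definable_pred (\<lambda>s. t s = u s)"
  by (rule definable_pred_subst2)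
     (auto simp: definable_pred_def interleave_def intro!: exI[of _ "Eq 0 2"])

lemma definable_var [definability]: "definable_fun (\<lambda>s. s i)"
  by (auto simp: definable_fun_def definable_pred_def interleave_def
      intro!: exI[of _ "Eq 0 (2 * Suc i)"])

lemma definable_parameter [definability]: "definable_fun (\<lambda>s. c)"
  by (auto simp: definable_fun_def definable_pred_def interleave_def
      intro!: exI[of _ "Eq 0 1"] exI[of _ "\<lambda>_. c"])

lemma definable_truth_value [definability]: "definable_pred (\<lambda>s. b)"
proof -
  have "definable_pred (\<lambda>s. undefined = (undefined :: 'a))" by (intro definability)
  then show ?thesis using definable_not by (cases b) fastforce+
qed

lemma definable_ex1 [definability]:
  assumes "definable_pred (\<lambda>s. P (\<lambda>n. s (Suc n)) (s 0))"
  shows "definable_pred (\<lambda>s. \<exists>!x. P s x)"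
  unfolding Ex1_def by (intro definability definable_pred_rename_tail[OF assms])

lemma definable_if [definability]:
  assumes "definable_pred P" "definable_fun t" "definable_fun u"
  shows "definable_fun (\<lambda>s. if P s then t s else u s)"
proof -
  have "definable_pred (\<lambda>s. (P (\<lambda>n. s (Suc n)) \<and> s 0 = t (\<lambda>n. s (Suc n))) \<or>
      (\<not> P (\<lambda>n. s (Suc n)) \<and> s 0 = u (\<lambda>n. s (Suc n))))"
    by (intro definability definable_pred_rename[OF assms(1)] definable_fun_rename[OF assms(2)]
        definable_fun_rename[OF assms(3)])
  then show ?thesis unfolding definable_fun_def by (rule back_subst[of definable_pred]) auto
qed

section \<open>Set existence\<close>

lemma set_eqI: "(\<And>x. x \<epsilon> a \<longleftrightarrow> x \<epsilon> b) \<Longrightarrow> a = b"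
  using ZF unfolding ZF_def extensionality_def by blast

definition is_set :: "('a \<Rightarrow> bool) \<Rightarrow> bool" where
  "is_set P \<longleftrightarrow> (\<exists>a. \<forall>x. x \<epsilon> a \<longleftrightarrow> P x)"

lemma is_set_cong: "is_set P \<Longrightarrow> (\<And>x. P x \<longleftrightarrow> Q x) \<Longrightarrow> is_set Q"
  unfolding is_set_def by simp

lemma SET_eq: "(\<And>x. x \<epsilon> a \<longleftrightarrow> P x) \<Longrightarrow> (SET x. P x) = a"
  unfolding set_of_def by (rule the_equality) (auto intro: set_eqI)

lemma mem_SET: "is_set P \<Longrightarrow> x \<epsilon> (SET x. P x) \<longleftrightarrow> P x"
  unfolding is_set_def using SET_eq by blast

lemma eq_SET_iff:
  "z = (SET x. P x) \<longleftrightarrow> (\<forall>x. x \<epsilon> z \<longleftrightarrow> P x) \<or> (\<not> is_set P \<and> z = (THE x. False))"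
proof (cases "is_set P")
  case True
  then show ?thesis using SET_eq[of z P] mem_SET[of P] by blast
next
  case False
  then have no_set: "\<not> (\<forall>x. x \<epsilon> a \<longleftrightarrow> P x)" for a unfolding is_set_def by blast
  then have "(SET x. P x) = (THE x. False)" unfolding set_of_def by (simp only:)
  with no_set False show ?thesis by (simp only: simp_thms)
qed

lemma definable_SET [definability]:
  assumes "definable_pred (\<lambda>s. P (\<lambda>n. s (Suc n)) (s 0))"
  shows "definable_fun (\<lambda>s. SET x. P s x)"
  unfolding definable_fun_def eq_SET_iff is_set_def
  by (intro definability definable_pred_rename_tail[OF assms])

lemma is_set_separation:
  assumes "class_pred P" "\<And>x. P x \<Longrightarrow> x \<epsilon> a" shows "is_set P"
proof -
  obtain p r where p: "\<And>s. P (s 0) \<longleftrightarrow> sat UNIV mem (interleave s r) p"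
    using assms(1) by (rule definable_predE) blast
  have "(interleave (\<lambda>_. a) r)(0 := x) = interleave ((\<lambda>_. a)(0 := x)) r" for x
    by (auto simp: interleave_def fun_eq_iff)
  then have "P x \<longleftrightarrow> sat UNIV mem ((interleave (\<lambda>_. a) r)(0 := x)) p" for x
    using p[of "(\<lambda>_. a)(0 := x)"] by simp
  moreover have "\<exists>b. \<forall>x. x \<epsilon> b \<longleftrightarrow> x \<epsilon> a \<and> sat UNIV mem ((interleave (\<lambda>_. a) r)(0 := x)) p"
    using ZF unfolding ZF_def separation_def by blast
  ultimately show ?thesis using assms(2) unfolding is_set_def by auto
qed

lemma mem_SET_separation:
  "class_pred P \<Longrightarrow> (\<And>x. P x \<Longrightarrow> x \<epsilon> a) \<Longrightarrow> x \<epsilon> (SET x. P x) \<longleftrightarrow> P x"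
  by (rule mem_SET[OF is_set_separation])

text \<open>The renaming moves the value of the function from the third variable, where
  \<^const>\<open>interleave\<close> puts it, to the second, where the replacement schema expects it.\<close>

lemma is_set_replacement:
  assumes "class_fun t" shows "is_set (\<lambda>y. \<exists>x. x \<epsilon> a \<and> y = t x)"
proof -
  have "definable_pred (\<lambda>s. s (Suc 0) = t (s 0))" by (intro definability assms)
  then obtain p r where p: "\<And>s. s (Suc 0) = t (s 0) \<longleftrightarrow> sat UNIV mem (interleave s r) p"
    by (rule definable_predE) blast
  define f where "f n = (if n = 2 then 1 else if n = 1 then 2 else n)" for n :: nat
  define s where "s n = interleave (\<lambda>_. a) r (f n)" for n
  obtain q where q: "\<And>s. sat UNIV mem s q \<longleftrightarrow> sat UNIV mem (\<lambda>n. s (f n)) p"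
    using ex_sat_rename by blast
  have "(\<lambda>n. (s(0 := x, 1 := y)) (f n)) = interleave ((\<lambda>_. a)(0 := x, Suc 0 := y)) r" for x y
    by (auto simp: interleave_def fun_eq_iff f_def s_def)
  then have sat_q: "sat UNIV mem (s(0 := x, 1 := y)) q \<longleftrightarrow> y = t x" for x y
    using p[of "(\<lambda>_. a)(0 := x, Suc 0 := y)"] unfolding q by simp
  have "(\<forall>x y z. x \<epsilon> a \<longrightarrow> sat UNIV mem (s(0 := x, 1 := y)) q \<longrightarrow>
        sat UNIV mem (s(0 := x, 1 := z)) q \<longrightarrow> y = z) \<longrightarrow>
     (\<exists>b. \<forall>y. y \<epsilon> b \<longleftrightarrow> (\<exists>x. x \<epsilon> a \<and> sat UNIV mem (s(0 := x, 1 := y)) q))"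
    using ZF unfolding ZF_def replacement_def by blast
  then show ?thesis unfolding sat_q is_set_def by simp
qed

definition sep :: "'a \<Rightarrow> ('a \<Rightarrow> bool) \<Rightarrow> 'a" where
  "sep A P = (SET x. x \<epsilon> A \<and> P x)"

lemma sep_iff: "class_pred P \<Longrightarrow> x \<epsilon> sep A P \<longleftrightarrow> x \<epsilon> A \<and> P x"
  unfolding sep_def by (rule mem_SET_separation[where a = A]) (intro definability, blast+)

lemma definable_sep [definability]:
  assumes "definable_fun A" "definable_pred (\<lambda>s. P (\<lambda>n. s (Suc n)) (s 0))"
  shows "definable_fun (\<lambda>s. sep (A s) (P s))"
  unfolding sep_def by (intro definability assms definable_fun_rename[OF assms(1)])

definition img :: "('a \<Rightarrow> 'a) \<Rightarrow> 'a \<Rightarrow> 'a" where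
  "img t A = (SET y. \<exists>x. x \<epsilon> A \<and> y = t x)"

lemma img_iff: "class_fun t \<Longrightarrow> y \<epsilon> img t A \<longleftrightarrow> (\<exists>x. x \<epsilon> A \<and> y = t x)"
  unfolding img_def by (intro mem_SET is_set_replacement)

lemma definable_img [definability]:
  assumes "definable_fun A" "definable_fun (\<lambda>s. t (\<lambda>n. s (Suc n)) (s 0))"
  shows "definable_fun (\<lambda>s. img (t s) (A s))"
  unfolding img_def
  by (intro definability definable_fun_rename[OF assms(1)] definable_fun_rename_tail[OF assms(2)])

section \<open>Sets and functions\<close>

lemma empty_iff [simp]: "\<not> x \<epsilon> empty"
  unfolding empty_def by (subst mem_SET_separation) (intro definability, simp_all)

lemma eq_empty_iff: "a = empty \<longleftrightarrow> (\<forall>x. \<not> x \<epsilon> a)"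
  using set_eqI[of a empty] by auto

lemma upair_iff [simp]: "x \<epsilon> upair a b \<longleftrightarrow> x = a \<or> x = b"
  unfolding upair_def
  by (rule mem_SET) (use ZF in \<open>auto simp: ZF_def pairing_def is_set_def\<close>)

lemma upair_eq_iff: "upair a b = upair c d \<longleftrightarrow> (a = c \<and> b = d) \<or> (a = d \<and> b = c)"
  by (auto simp: upair_iff intro!: set_eqI) (metis upair_iff)+

lemma opair_eq_iff [simp]: "opair a b = opair c d \<longleftrightarrow> a = c \<and> b = d"
  unfolding opair_def upair_eq_iff by auto

lemma is_set_Union: "is_set (\<lambda>x. \<exists>y. y \<epsilon> a \<and> x \<epsilon> y)"
  using ZF unfolding ZF_def union_axiom_def is_set_def by blast

lemma is_set_UN:
  assumes "class_fun t" shows "is_set (\<lambda>z. \<exists>x. x \<epsilon> A \<and> z \<epsilon> t x)"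
  by (rule is_set_cong[OF is_set_Union[of "img t A"]]) (auto simp: img_iff[OF assms])

definition un :: "'a \<Rightarrow> 'a \<Rightarrow> 'a" where
  "un a b = (SET x. x \<epsilon> a \<or> x \<epsilon> b)"

lemma un_iff [simp]: "x \<epsilon> un a b \<longleftrightarrow> x \<epsilon> a \<or> x \<epsilon> b"
  unfolding un_def by (rule mem_SET, rule is_set_cong[OF is_set_Union[of "upair a b"]]) auto

lemma suc_iff [simp]: "x \<epsilon> suc a \<longleftrightarrow> x \<epsilon> a \<or> x = a"
  unfolding suc_def
  by (rule mem_SET_separation[where a = "un a (upair a a)"]) (intro definability, auto)

lemma suc_neq_empty [simp]: "suc a \<noteq> empty" "empty \<noteq> suc a"
  using suc_iff[of a a] empty_iff[of a] by metis+

lemma power_set_iff [simp]: "x \<epsilon> power_set a \<longleftrightarrow> subset x a"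
  unfolding power_set_def
  by (rule mem_SET) (use ZF in \<open>auto simp: ZF_def power_set_axiom_def is_set_def subset_def\<close>)

lemma definable_upair [definability]:
  "definable_fun t \<Longrightarrow> definable_fun u \<Longrightarrow> definable_fun (\<lambda>s. upair (t s) (u s))"
  by (rule definable_fun_subst2) (unfold upair_def, intro definability)

lemma definable_opair [definability]:
  "definable_fun t \<Longrightarrow> definable_fun u \<Longrightarrow> definable_fun (\<lambda>s. opair (t s) (u s))"
  unfolding opair_def by (intro definability)

lemma definable_suc [definability]: "definable_fun t \<Longrightarrow> definable_fun (\<lambda>s. suc (t s))"
  by (rule definable_fun_subst1) (unfold suc_def, intro definability)

lemma definable_un [definability]:
  "definable_fun t \<Longrightarrow> definable_fun u \<Longrightarrow> definable_fun (\<lambda>s. un (t s) (u s))"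
  by (rule definable_fun_subst2) (unfold un_def, intro definability)

lemma definable_subset [definability]:
  "definable_fun t \<Longrightarrow> definable_fun u \<Longrightarrow> definable_pred (\<lambda>s. subset (t s) (u s))"
  by (rule definable_pred_subst2) (unfold subset_def, intro definability)

lemma is_set_Sigma:
  assumes "class_fun t" shows "is_set (\<lambda>p. \<exists>x y. x \<epsilon> A \<and> y \<epsilon> t x \<and> p = opair x y)"
proof -
  have pairs: "class_fun (opair x)" for x by (intro definability)
  have "is_set (\<lambda>p. \<exists>x. x \<epsilon> A \<and> p \<epsilon> img (opair x) (t x))"
    by (rule is_set_UN) (intro definability assms)
  then show ?thesis by (rule is_set_cong) (auto simp: img_iff[OF pairs])
qed

definition product :: "'a \<Rightarrow> 'a \<Rightarrow> 'a" where
  "product A B = (SET p. \<exists>x y. x \<epsilon> A \<and> y \<epsilon> B \<and> p = opair x y)"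

lemma product_iff: "p \<epsilon> product A B \<longleftrightarrow> (\<exists>x y. x \<epsilon> A \<and> y \<epsilon> B \<and> p = opair x y)"
  unfolding product_def by (intro mem_SET is_set_Sigma definability)

lemma opair_product_iff [simp]: "opair x y \<epsilon> product A B \<longleftrightarrow> x \<epsilon> A \<and> y \<epsilon> B"
  by (auto simp: product_iff)

lemma definable_product [definability]:
  "definable_fun t \<Longrightarrow> definable_fun u \<Longrightarrow> definable_fun (\<lambda>s. product (t s) (u s))"
  by (rule definable_fun_subst2) (unfold product_def, intro definability)

text \<open>A definable version of unique choice: unlike \<open>THE\<close>, its value is definable even on
  predicates satisfied by several sets.\<close>

definition the_set :: "('a \<Rightarrow> bool) \<Rightarrow> 'a" where
  "the_set Q = (SET z. \<exists>y. Q y \<and> z \<epsilon> y)"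

lemma the_set_eq: "Q y \<Longrightarrow> (\<And>y'. Q y' \<Longrightarrow> y' = y) \<Longrightarrow> the_set Q = y"
  unfolding the_set_def by (rule SET_eq) blast

lemma definable_the_set [definability]:
  assumes "definable_pred (\<lambda>s. Q (\<lambda>n. s (Suc n)) (s 0))"
  shows "definable_fun (\<lambda>s. the_set (\<lambda>y. Q s y))"
  unfolding the_set_def by (intro definability definable_pred_rename_tail[OF assms])

definition pfst :: "'a \<Rightarrow> 'a" where "pfst p = the_set (\<lambda>x. \<exists>y. p = opair x y)"
definition psnd :: "'a \<Rightarrow> 'a" where "psnd p = the_set (\<lambda>y. \<exists>x. p = opair x y)"

lemma pfst_opair [simp]: "pfst (opair x y) = x"
  unfolding pfst_def by (rule the_set_eq) auto

lemma psnd_opair [simp]: "psnd (opair x y) = y"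
  unfolding psnd_def by (rule the_set_eq) auto

lemma definable_pfst [definability]: "definable_fun t \<Longrightarrow> definable_fun (\<lambda>s. pfst (t s))"
  by (rule definable_fun_subst1) (unfold pfst_def, intro definability)

lemma definable_psnd [definability]: "definable_fun t \<Longrightarrow> definable_fun (\<lambda>s. psnd (t s))"
  by (rule definable_fun_subst1) (unfold psnd_def, intro definability)

text \<open>The definable counterpart of \<^const>\<open>app\<close>, with which it agrees on the domain of a function.\<close>

definition fun_val :: "'a \<Rightarrow> 'a \<Rightarrow> 'a" (infixl \<open>\<cdot>\<close> 90) where
  "f \<cdot> x = the_set (\<lambda>y. opair x y \<epsilon> f)"

lemma definable_fun_val [definability]:
  "definable_fun t \<Longrightarrow> definable_fun u \<Longrightarrow> definable_fun (\<lambda>s. t s \<cdot> u s)"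
  by (rule definable_fun_subst2) (unfold fun_val_def, intro definability)

lemma opair_mem_fun_iff:
  assumes "fun_on f A" "x \<epsilon> A" shows "opair x y \<epsilon> f \<longleftrightarrow> y = app f x"
proof -
  have unique: "\<exists>!y. opair x y \<epsilon> f" using assms unfolding fun_on_def by blast
  show ?thesis unfolding app_def using theI'[OF unique] the1_equality[OF unique, of y] by auto
qed

lemma fun_val_eq: "opair x y \<epsilon> f \<Longrightarrow> (\<And>y'. opair x y' \<epsilon> f \<Longrightarrow> y' = y) \<Longrightarrow> f \<cdot> x = y"
  unfolding fun_val_def by (rule the_set_eq)

lemma app_eq_fun_val: "fun_on f A \<Longrightarrow> x \<epsilon> A \<Longrightarrow> app f x = f \<cdot> x"
  by (rule sym, rule fun_val_eq) (auto simp: opair_mem_fun_iff)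

lemma mem_fun_iff:
  assumes "fun_on f A" shows "p \<epsilon> f \<longleftrightarrow> (\<exists>x. x \<epsilon> A \<and> p = opair x (f \<cdot> x))"
proof
  assume p: "p \<epsilon> f"
  then obtain x y where xy: "x \<epsilon> A" "p = opair x y" using assms unfolding fun_on_def by blast
  then show "\<exists>x. x \<epsilon> A \<and> p = opair x (f \<cdot> x)"
    using p opair_mem_fun_iff[OF assms] app_eq_fun_val[OF assms] by auto
next
  assume "\<exists>x. x \<epsilon> A \<and> p = opair x (f \<cdot> x)"
  then show "p \<epsilon> f" using opair_mem_fun_iff[OF assms] app_eq_fun_val[OF assms] by auto
qed

lemma fun_on_eqI:
  assumes "fun_on f A" "fun_on g A" "\<And>x. x \<epsilon> A \<Longrightarrow> f \<cdot> x = g \<cdot> x" shows "f = g"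
proof (rule set_eqI)
  fix p
  show "p \<epsilon> f \<longleftrightarrow> p \<epsilon> g"
    using assms mem_fun_iff[OF assms(1), of p] mem_fun_iff[OF assms(2), of p] by auto
qed

definition lam :: "'a \<Rightarrow> ('a \<Rightarrow> 'a) \<Rightarrow> 'a" where
  "lam A t = img (\<lambda>x. opair x (t x)) A"

lemma definable_lam [definability]:
  assumes "definable_fun A" "definable_fun (\<lambda>s. t (\<lambda>n. s (Suc n)) (s 0))"
  shows "definable_fun (\<lambda>s. lam (A s) (\<lambda>x. t s x))"
  unfolding lam_def by (intro definability assms)

lemma mem_lam: "class_fun t \<Longrightarrow> p \<epsilon> lam A t \<longleftrightarrow> (\<exists>x. x \<epsilon> A \<and> p = opair x (t x))"
  unfolding lam_def by (intro img_iff definability)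

lemma fun_on_lam: "class_fun t \<Longrightarrow> fun_on (lam A t) A"
  unfolding fun_on_def by (auto simp: mem_lam)

lemma fun_val_lam: "class_fun t \<Longrightarrow> x \<epsilon> A \<Longrightarrow> lam A t \<cdot> x = t x"
  by (rule fun_val_eq) (auto simp: mem_lam)

lemma app_lam: "class_fun t \<Longrightarrow> x \<epsilon> A \<Longrightarrow> app (lam A t) x = t x"
  using app_eq_fun_val[OF fun_on_lam] fun_val_lam by metis

lemma maps_iff: "maps f A B \<longleftrightarrow> fun_on f A \<and> (\<forall>x. x \<epsilon> A \<longrightarrow> f \<cdot> x \<epsilon> B)"
  unfolding maps_def using app_eq_fun_val by auto

lemma maps_fun_on: "maps f A B \<Longrightarrow> fun_on f A"
  by (simp add: maps_iff)

lemma maps_mem: "maps f A B \<Longrightarrow> x \<epsilon> A \<Longrightarrow> f \<cdot> x \<epsilon> B"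
  by (simp add: maps_iff)

lemma maps_app: "maps f A B \<Longrightarrow> x \<epsilon> A \<Longrightarrow> app f x = f \<cdot> x"
  using app_eq_fun_val maps_fun_on by blast

lemma maps_lam: "class_fun t \<Longrightarrow> (\<And>x. x \<epsilon> A \<Longrightarrow> t x \<epsilon> B) \<Longrightarrow> maps (lam A t) A B"
  by (simp add: maps_iff fun_on_lam fun_val_lam)

lemma maps_subset_product: "maps f A B \<Longrightarrow> subset f (product A B)"
  unfolding maps_iff subset_def by (auto simp: mem_fun_iff)

lemma definable_fun_on [definability]:
  "definable_fun t \<Longrightarrow> definable_fun u \<Longrightarrow> definable_pred (\<lambda>s. fun_on (t s) (u s))"
  by (rule definable_pred_subst2) (unfold fun_on_def, intro definability)

lemma definable_maps [definability]:
  "definable_fun t \<Longrightarrow> definable_fun u \<Longrightarrow> definable_fun v \<Longrightarrow>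
    definable_pred (\<lambda>s. maps (t s) (u s) (v s))"
  by (rule definable_pred_subst3) (unfold maps_iff, intro definability)

lemma fun_space_iff: "f \<epsilon> fun_space A B \<longleftrightarrow> maps f A B"
  unfolding fun_space_def
  by (rule mem_SET_separation[where a = "power_set (product A B)"])
     (intro definability, simp add: maps_subset_product)

lemma restr_iff: "p \<epsilon> restr f A \<longleftrightarrow> p \<epsilon> f \<and> (\<exists>x y. x \<epsilon> A \<and> p = opair x y)"
  unfolding restr_def by (rule mem_SET_separation[where a = f]) (intro definability, simp)

lemma restr_empty: "restr f empty = empty"
  by (simp add: eq_empty_iff restr_iff)

section \<open>Injections and bijections\<close>

lemma inj_from_to_iff: "inj_from_to f A B \<longleftrightarrow> maps f A B \<and>
    (\<forall>x y. x \<epsilon> A \<longrightarrow> y \<epsilon> A \<longrightarrow> f \<cdot> x = f \<cdot> y \<longrightarrow> x = y)"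
  unfolding inj_from_to_def using maps_app by auto

lemma inj_from_to_fun_on: "inj_from_to f A B \<Longrightarrow> fun_on f A"
  by (simp add: inj_from_to_iff maps_iff)

lemma inj_from_to_mem: "inj_from_to f A B \<Longrightarrow> x \<epsilon> A \<Longrightarrow> f \<cdot> x \<epsilon> B"
  by (simp add: inj_from_to_iff maps_iff)

lemma inj_from_to_eq_iff: "inj_from_to f A B \<Longrightarrow> x \<epsilon> A \<Longrightarrow> y \<epsilon> A \<Longrightarrow> f \<cdot> x = f \<cdot> y \<longleftrightarrow> x = y"
  by (auto simp: inj_from_to_iff)

lemma definable_inj_from_to [definability]:
  "definable_fun t \<Longrightarrow> definable_fun u \<Longrightarrow> definable_fun v \<Longrightarrow>
    definable_pred (\<lambda>s. inj_from_to (t s) (u s) (v s))"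
  by (rule definable_pred_subst3) (unfold inj_from_to_iff, intro definability)

lemma definable_injects [definability]:
  "definable_fun t \<Longrightarrow> definable_fun u \<Longrightarrow> definable_pred (\<lambda>s. injects (t s) (u s))"
  by (rule definable_pred_subst2) (unfold injects_def, intro definability)

definition fun_inv :: "'a \<Rightarrow> 'a \<Rightarrow> 'a \<Rightarrow> 'a" where
  "fun_inv f A y = the_set (\<lambda>x. x \<epsilon> A \<and> f \<cdot> x = y)"

lemma fun_inv_fun_val: "inj_from_to f A B \<Longrightarrow> x \<epsilon> A \<Longrightarrow> fun_inv f A (f \<cdot> x) = x"
  unfolding fun_inv_def by (rule the_set_eq) (auto simp: inj_from_to_eq_iff)

lemma definable_fun_inv [definability]:
  "definable_fun t \<Longrightarrow> definable_fun u \<Longrightarrow> definable_fun (\<lambda>s. fun_inv f (t s) (u s))"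
  by (rule definable_fun_subst2) (unfold fun_inv_def, intro definability)

lemma injectsI:
  assumes "class_fun t" "\<And>x. x \<epsilon> A \<Longrightarrow> t x \<epsilon> B"
    "\<And>x y. x \<epsilon> A \<Longrightarrow> y \<epsilon> A \<Longrightarrow> t x = t y \<Longrightarrow> x = y"
  shows "injects A B"
  unfolding injects_def inj_from_to_iff
  by (rule exI[of _ "lam A t"]) (use assms in \<open>simp add: maps_lam fun_val_lam\<close>)

lemma injectsE:
  assumes "injects A B" obtains f where "inj_from_to f A B"
  using assms unfolding injects_def by blast

lemma injects_trans:
  assumes "injects A B" "injects B C" shows "injects A C"
proof -
  obtain f where f: "inj_from_to f A B" using assms(1) by (rule injectsE)
  obtain g where g: "inj_from_to g B C" using assms(2) by (rule injectsE)
  show ?thesis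
  proof (rule injectsI[where t = "\<lambda>x. g \<cdot> (f \<cdot> x)"])
    show "class_fun (\<lambda>x. g \<cdot> (f \<cdot> x))" by (intro definability)
  qed (auto simp: inj_from_to_mem[OF f] inj_from_to_mem[OF g]
      inj_from_to_eq_iff[OF f] inj_from_to_eq_iff[OF g])
qed

lemma subset_imp_injects: "subset A B \<Longrightarrow> injects A B"
  by (rule injectsI[where t = "\<lambda>x. x"]) (auto simp: subset_def intro: definable_var)

lemma injects_refl: "injects A A"
  by (rule subset_imp_injects) (simp add: subset_def)

lemma in_bijectionI:
  assumes "class_fun t" "\<And>x. x \<epsilon> A \<Longrightarrow> t x \<epsilon> B"
    "\<And>x y. x \<epsilon> A \<Longrightarrow> y \<epsilon> A \<Longrightarrow> t x = t y \<Longrightarrow> x = y"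
    "\<And>y. y \<epsilon> B \<Longrightarrow> \<exists>x. x \<epsilon> A \<and> t x = y"
  shows "in_bijection A B"
proof -
  have "\<exists>x. x \<epsilon> A \<and> app (lam A t) x = y" if "y \<epsilon> B" for y
    using assms(4)[OF that] app_lam[OF assms(1)] by auto
  then show ?thesis unfolding in_bijection_def inj_from_to_def surj_from_to_def
    by (intro exI[of _ "lam A t"]) (use assms(1-3) in \<open>simp add: maps_lam app_lam\<close>)
qed

lemma in_bijectionE:
  assumes "in_bijection A B"
  obtains f where "inj_from_to f A B" "\<And>y. y \<epsilon> B \<Longrightarrow> \<exists>x. x \<epsilon> A \<and> f \<cdot> x = y"
  using assms unfolding in_bijection_def surj_from_to_def by (metis maps_app)

lemma knaster_tarski:
  assumes \<phi>: "class_rel \<phi>" and in_A: "\<And>S x. \<phi> S x \<Longrightarrow> x \<epsilon> A"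
    and mono: "\<And>S T x. subset S T \<Longrightarrow> \<phi> S x \<Longrightarrow> \<phi> T x"
  obtains D where "\<And>x. x \<epsilon> D \<longleftrightarrow> \<phi> D x"
proof -
  note [definability] = definable_pred_subst2[OF \<phi>]
  define D where "D = (SET x. \<exists>S. x \<epsilon> S \<and> (\<forall>y. y \<epsilon> S \<longrightarrow> \<phi> S y))"
  have D: "x \<epsilon> D \<longleftrightarrow> (\<exists>S. x \<epsilon> S \<and> (\<forall>y. y \<epsilon> S \<longrightarrow> \<phi> S y))" for x
    unfolding D_def
    by (rule mem_SET_separation[where a = A]) (intro definability, use in_A in blast)
  have post: "\<phi> D x" if x: "x \<epsilon> D" for x
  proof -
    obtain S where S: "x \<epsilon> S" "\<forall>y. y \<epsilon> S \<longrightarrow> \<phi> S y" using x unfolding D by blast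
    then have "subset S D" unfolding subset_def D by blast
    then show ?thesis using S mono by blast
  qed
  have "x \<epsilon> D" if "\<phi> D x" for x
  proof -
    have "y \<epsilon> sep A (\<phi> D) \<longleftrightarrow> \<phi> D y" for y
      using in_A by (subst sep_iff) (intro definability, blast)
    then have "subset D (sep A (\<phi> D))" "x \<epsilon> sep A (\<phi> D)"
      and "\<forall>y. y \<epsilon> sep A (\<phi> D) \<longrightarrow> \<phi> D y"
      using post that unfolding subset_def by blast+
    then show ?thesis unfolding D using mono by blast
  qed
  then show ?thesis using post that by blast
qed

text \<open>With \<open>D\<close> a fixed point of \<open>S \<mapsto> A - g[B - f[S]]\<close>, the bijection is \<open>f\<close> on \<open>D\<close> and the inverse
  of \<open>g\<close> off \<open>D\<close>.\<close>

lemma cantor_bernstein: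
  assumes "injects A B" "injects B A" shows "in_bijection A B"
proof -
  obtain f where f: "inj_from_to f A B" using assms(1) by (rule injectsE)
  obtain g where g: "inj_from_to g B A" using assms(2) by (rule injectsE)
  define \<phi> where "\<phi> S x \<longleftrightarrow>
      x \<epsilon> A \<and> \<not> (\<exists>b. b \<epsilon> B \<and> \<not> (\<exists>y. y \<epsilon> S \<and> f \<cdot> y = b) \<and> g \<cdot> b = x)" for S x
  have "class_rel \<phi>" unfolding \<phi>_def by (intro definability)
  then obtain D where "\<And>x. x \<epsilon> D \<longleftrightarrow> \<phi> D x"
    by (rule knaster_tarski[where A = A]) (unfold \<phi>_def subset_def, blast+)
  note D = this[unfolded \<phi>_def]
  define h where "h x = (if x \<epsilon> D then f \<cdot> x else fun_inv g B x)" for x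
  have h_D: "h x = f \<cdot> x" "x \<epsilon> A" if "x \<epsilon> D" for x
    using that D[of x] unfolding h_def by simp_all
  have h_not_D: "h x \<epsilon> B" "g \<cdot> h x = x" "\<not> (\<exists>y. y \<epsilon> D \<and> f \<cdot> y = h x)"
    if x: "x \<epsilon> A" "\<not> x \<epsilon> D" for x
  proof -
    obtain b where b: "b \<epsilon> B" "g \<cdot> b = x" "\<not> (\<exists>y. y \<epsilon> D \<and> f \<cdot> y = b)"
      using x D[of x] by blast
    then have "h x = b" using x(2) fun_inv_fun_val[OF g b(1)] unfolding h_def by auto
    then show "h x \<epsilon> B" "g \<cdot> h x = x" "\<not> (\<exists>y. y \<epsilon> D \<and> f \<cdot> y = h x)" using b by blast+
  qed
  show ?thesis
  proof (rule in_bijectionI)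
    show "class_fun h" unfolding h_def by (intro definability)
    show "h x \<epsilon> B" if "x \<epsilon> A" for x
      using that h_D h_not_D(1) inj_from_to_mem[OF f] by (cases "x \<epsilon> D") auto
    show "x = y" if "x \<epsilon> A" "y \<epsilon> A" "h x = h y" for x y
      using that h_D[of x] h_D[of y] h_not_D[of x] h_not_D[of y] inj_from_to_eq_iff[OF f, of x y]
      by (cases "x \<epsilon> D"; cases "y \<epsilon> D") metis+
    show "\<exists>x. x \<epsilon> A \<and> h x = b" if "b \<epsilon> B" for b
    proof (cases "\<exists>y. y \<epsilon> D \<and> f \<cdot> y = b")
      case True then show ?thesis using h_D by blast
    next
      case False
      then have "\<not> g \<cdot> b \<epsilon> D" using D[of "g \<cdot> b"] that by blast
      then have "h (g \<cdot> b) = b" unfolding h_def using fun_inv_fun_val[OF g that] by simp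
      then show ?thesis using inj_from_to_mem[OF g that] by blast
    qed
  qed
qed

lemma in_bijection_iff_injects: "in_bijection A B \<longleftrightarrow> injects A B \<and> injects B A"
proof
  assume "in_bijection A B"
  then obtain f where f: "inj_from_to f A B" "\<And>y. y \<epsilon> B \<Longrightarrow> \<exists>x. x \<epsilon> A \<and> f \<cdot> x = y"
    by (rule in_bijectionE) blast
  have inv: "fun_inv f A y \<epsilon> A \<and> f \<cdot> fun_inv f A y = y" if "y \<epsilon> B" for y
    using f(2)[OF that] fun_inv_fun_val[OF f(1)] by auto
  have "injects B A"
  proof (rule injectsI[where t = "fun_inv f A"])
    show "class_fun (fun_inv f A)" by (intro definability)
  qed (use inv in blast, use inv in metis)
  then show "injects A B \<and> injects B A" using f(1) unfolding injects_def by blast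
qed (blast intro: cantor_bernstein)

lemma injects_product_mono:
  assumes "injects A A'" "injects B B'" shows "injects (product A B) (product A' B')"
proof -
  obtain a where a: "inj_from_to a A A'" using assms(1) by (rule injectsE)
  obtain b where b: "inj_from_to b B B'" using assms(2) by (rule injectsE)
  show ?thesis
  proof (rule injectsI[where t = "\<lambda>p. opair (a \<cdot> pfst p) (b \<cdot> psnd p)"])
    show "class_fun (\<lambda>p. opair (a \<cdot> pfst p) (b \<cdot> psnd p))" by (intro definability)
  qed (auto simp: product_iff inj_from_to_mem[OF a] inj_from_to_mem[OF b]
      inj_from_to_eq_iff[OF a] inj_from_to_eq_iff[OF b])
qed

lemma disjoint_sum_iff: "p \<epsilon> disjoint_sum A B \<longleftrightarrow>
    (\<exists>x. x \<epsilon> A \<and> p = opair empty x) \<or> (\<exists>y. y \<epsilon> B \<and> p = opair (suc empty) y)"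
  unfolding disjoint_sum_def
  by (rule mem_SET_separation[where a = "product (upair empty (suc empty)) (un A B)"])
     (intro definability, auto)

lemma opair_disjoint_sum_iff [simp]:
  "opair empty x \<epsilon> disjoint_sum A B \<longleftrightarrow> x \<epsilon> A" "opair (suc empty) y \<epsilon> disjoint_sum A B \<longleftrightarrow> y \<epsilon> B"
  by (auto simp: disjoint_sum_iff)

lemma definable_disjoint_sum [definability]:
  "definable_fun t \<Longrightarrow> definable_fun u \<Longrightarrow> definable_fun (\<lambda>s. disjoint_sum (t s) (u s))"
  by (rule definable_fun_subst2) (unfold disjoint_sum_def, intro definability)

lemma injects_disjoint_sum_mono:
  assumes "injects A A'" "injects B B'" shows "injects (disjoint_sum A B) (disjoint_sum A' B')"
proof -
  obtain a where a: "inj_from_to a A A'" using assms(1) by (rule injectsE)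
  obtain b where b: "inj_from_to b B B'" using assms(2) by (rule injectsE)
  let ?t = "\<lambda>p. opair (pfst p) (if pfst p = empty then a \<cdot> psnd p else b \<cdot> psnd p)"
  show ?thesis
  proof (rule injectsI[where t = ?t])
    show "class_fun ?t" by (intro definability)
  qed (auto simp: disjoint_sum_iff inj_from_to_mem[OF a] inj_from_to_mem[OF b]
      inj_from_to_eq_iff[OF a] inj_from_to_eq_iff[OF b])
qed

lemma injects_power_set_mono:
  assumes "injects A B" shows "injects (power_set A) (power_set B)"
proof -
  obtain c where c: "inj_from_to c A B" using assms by (rule injectsE)
  have c_img: "y \<epsilon> img ((\<cdot>) c) S \<longleftrightarrow> (\<exists>x. x \<epsilon> S \<and> y = c \<cdot> x)" for y S
    by (rule img_iff) (intro definability)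
  have mem_img: "c \<cdot> x \<epsilon> img ((\<cdot>) c) S \<longleftrightarrow> x \<epsilon> S" if "x \<epsilon> A" "subset S A" for x S
    using inj_from_to_eq_iff[OF c that(1)] that(2) unfolding c_img subset_def by blast
  show ?thesis
  proof (rule injectsI[where t = "img ((\<cdot>) c)"])
    show "class_fun (img ((\<cdot>) c))" by (intro definability)
    show "img ((\<cdot>) c) S \<epsilon> power_set B" if "S \<epsilon> power_set A" for S
      using that inj_from_to_mem[OF c] by (auto simp: subset_def c_img)
    fix S T assume "S \<epsilon> power_set A" "T \<epsilon> power_set A" and eq: "img ((\<cdot>) c) S = img ((\<cdot>) c) T"
    then have "subset S A" "subset T A" by simp_all
    moreover from this have "x \<epsilon> S \<longleftrightarrow> x \<epsilon> T" if "x \<epsilon> A" for x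
      using mem_img[OF that] eq by metis
    ultimately show "S = T" by (intro set_eqI) (auto simp: subset_def)
  qed
qed

lemma injects_product_power_set:
  "injects (product (power_set A) (power_set B)) (power_set (disjoint_sum A B))"
proof (rule injectsI[where t = "\<lambda>p. disjoint_sum (pfst p) (psnd p)"])
  show "class_fun (\<lambda>p. disjoint_sum (pfst p) (psnd p))" by (intro definability)
  show "disjoint_sum (pfst p) (psnd p) \<epsilon> power_set (disjoint_sum A B)"
    if "p \<epsilon> product (power_set A) (power_set B)" for p
    using that by (auto simp: product_iff subset_def disjoint_sum_iff)
  fix p q
  assume pq: "p \<epsilon> product (power_set A) (power_set B)" "q \<epsilon> product (power_set A) (power_set B)"
    and eq: "disjoint_sum (pfst p) (psnd p) = disjoint_sum (pfst q) (psnd q)"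
  have "pfst p = pfst q" by (rule set_eqI) (metis eq opair_disjoint_sum_iff(1))
  moreover have "psnd p = psnd q" by (rule set_eqI) (metis eq opair_disjoint_sum_iff(2))
  ultimately show "p = q" using pq by (auto simp: product_iff)
qed

section \<open>Ordinals\<close>

lemma foundation_min:
  assumes "x \<epsilon> a" obtains m where "m \<epsilon> a" "\<And>y. y \<epsilon> m \<Longrightarrow> \<not> y \<epsilon> a"
  using assms ZF unfolding ZF_def foundation_def by blast

lemma mem_asym: "x \<epsilon> y \<Longrightarrow> \<not> y \<epsilon> x"
proof -
  obtain m where "m \<epsilon> upair x y" "\<And>z. z \<epsilon> m \<Longrightarrow> \<not> z \<epsilon> upair x y"
    using foundation_min[of x "upair x y"] by (metis upair_iff)
  then show "x \<epsilon> y \<Longrightarrow> \<not> y \<epsilon> x" by auto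
qed

lemma not_mem_self [simp]: "\<not> x \<epsilon> x"
  using mem_asym by blast

lemma suc_inject [simp]: "suc a = suc b \<longleftrightarrow> a = b"
proof
  assume "suc a = suc b"
  then have "a \<epsilon> suc b" "b \<epsilon> suc a" using suc_iff[of a a] suc_iff[of b b] by auto
  then show "a = b" using mem_asym by auto
qed simp

lemma ordinal_mem: "ordinal a \<Longrightarrow> x \<epsilon> a \<Longrightarrow> ordinal x"
  unfolding ordinal_def transitive_def subset_def by blast

lemma ordinal_trans: "ordinal a \<Longrightarrow> x \<epsilon> y \<Longrightarrow> y \<epsilon> a \<Longrightarrow> x \<epsilon> a"
  unfolding ordinal_def transitive_def subset_def by blast

lemma ordinalI: "(\<And>x y. x \<epsilon> a \<Longrightarrow> y \<epsilon> x \<Longrightarrow> y \<epsilon> a) \<Longrightarrow> (\<And>x. x \<epsilon> a \<Longrightarrow> ordinal x) \<Longrightarrow> ordinal a"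
  unfolding ordinal_def transitive_def subset_def by blast

lemma ordinal_mem_subset: "ordinal a \<Longrightarrow> b \<epsilon> a \<Longrightarrow> subset b a"
  unfolding ordinal_def transitive_def by blast

lemma ordinal_empty: "ordinal empty"
  by (rule ordinalI) auto

lemma ordinal_suc: "ordinal a \<Longrightarrow> ordinal (suc a)"
  by (rule ordinalI) (auto intro: ordinal_trans ordinal_mem)

lemma ordinal_UN:
  assumes "\<And>z. z \<epsilon> u \<longleftrightarrow> (\<exists>x. x \<epsilon> A \<and> z \<epsilon> t x)" "\<And>x. x \<epsilon> A \<Longrightarrow> ordinal (t x)"
  shows "ordinal u"
  by (rule ordinalI) (use assms ordinal_trans ordinal_mem in blast)+

lemma definable_ordinal [definability]: "definable_fun t \<Longrightarrow> definable_pred (\<lambda>s. ordinal (t s))"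
  by (rule definable_pred_subst1) (unfold ordinal_def transitive_def, intro definability)

lemma ex_minimal_ordinal:
  assumes P: "class_pred P" and a: "ordinal a" "P a"
  obtains m where "ordinal m" "P m" "\<And>b. b \<epsilon> m \<Longrightarrow> \<not> P b"
proof -
  have "a \<epsilon> sep (suc a) P" using a(2) by (simp add: sep_iff[OF P])
  then obtain m where m: "m \<epsilon> sep (suc a) P" "\<And>b. b \<epsilon> m \<Longrightarrow> \<not> b \<epsilon> sep (suc a) P"
    by (rule foundation_min) blast
  then have m': "m \<epsilon> suc a" "P m" unfolding sep_iff[OF P] by blast+
  have "\<not> P b" if "b \<epsilon> m" for b
    using m(2)[OF that] ordinal_trans[OF ordinal_suc[OF a(1)] that m'(1)] unfolding sep_iff[OF P]
    by blast
  then show ?thesis using that m' ordinal_mem[OF ordinal_suc[OF a(1)]] by blast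
qed

lemma ordinal_induct [consumes 1, case_names definable ordinal]:
  assumes "ordinal a" "class_pred P" "\<And>a. ordinal a \<Longrightarrow> (\<And>b. b \<epsilon> a \<Longrightarrow> P b) \<Longrightarrow> P a"
  shows "P a"
proof (rule ccontr)
  assume "\<not> P a"
  moreover have "class_pred (\<lambda>x. \<not> P x)" by (intro definability assms(2))
  ultimately obtain m where "ordinal m" "\<not> P m" "\<And>b. b \<epsilon> m \<Longrightarrow> \<not> \<not> P b"
    using ex_minimal_ordinal[of "\<lambda>x. \<not> P x" a] assms(1) by blast
  then show False using assms(3) by blast
qed

lemma ordinal_linear:
  assumes "ordinal a" "ordinal b" shows "a \<epsilon> b \<or> a = b \<or> b \<epsilon> a"
  using assms
proof (induction a arbitrary: b rule: ordinal_induct)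
  case definable
  show ?case by (intro definability)
next
  case (ordinal a)
  from \<open>ordinal b\<close> show ?case
  proof (induction b rule: ordinal_induct)
    case definable
    show ?case by (intro definability)
  next
    case b: (ordinal b)
    have "a = b" if not_mem: "\<not> a \<epsilon> b" "\<not> b \<epsilon> a"
    proof (rule set_eqI)
      fix x
      have "x \<epsilon> b" if "x \<epsilon> a"
        using ordinal.IH[OF that b.hyps] ordinal_trans[OF ordinal.hyps _ that] not_mem that by blast
      moreover have "x \<epsilon> a" if "x \<epsilon> b"
        using b.IH[OF that] ordinal_trans[OF b.hyps _ that] not_mem that by blast
      ultimately show "x \<epsilon> a \<longleftrightarrow> x \<epsilon> b" by blast
    qed
    then show ?case by blast
  qed
qed

definition least_ordinal :: "('a \<Rightarrow> bool) \<Rightarrow> 'a" where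
  "least_ordinal P = the_set (\<lambda>a. ordinal a \<and> P a \<and> (\<forall>b. b \<epsilon> a \<longrightarrow> \<not> P b))"

lemma definable_least_ordinal [definability]:
  assumes "definable_pred (\<lambda>s. P (\<lambda>n. s (Suc n)) (s 0))"
  shows "definable_fun (\<lambda>s. least_ordinal (P s))"
  unfolding least_ordinal_def by (intro definability definable_pred_rename_tail[OF assms])

lemma least_ordinal:
  assumes "class_pred P" "ordinal a" "P a"
  shows "P (least_ordinal P)"
proof -
  obtain m where m: "ordinal m" "P m" "\<And>b. b \<epsilon> m \<Longrightarrow> \<not> P b"
    using ex_minimal_ordinal assms by blast
  then have "least_ordinal P = m"
    unfolding least_ordinal_def by (intro the_set_eq) (use m ordinal_linear[of _ m] in blast)+
  then show ?thesis using m(2) by simp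
qed

lemma ordinal_isomorphism_identity:
  assumes d: "ordinal d" and e: "ordinal e" and h: "class_fun h"
    and into: "\<And>u. u \<epsilon> d \<Longrightarrow> h u \<epsilon> e" and onto: "\<And>v. v \<epsilon> e \<Longrightarrow> \<exists>u. u \<epsilon> d \<and> v = h u"
    and order: "\<And>u v. u \<epsilon> d \<Longrightarrow> v \<epsilon> d \<Longrightarrow> h u \<epsilon> h v \<longleftrightarrow> u \<epsilon> v"
  shows "d = e" "u \<epsilon> d \<Longrightarrow> h u = u"
proof -
  have id: "h u = u" if "u \<epsilon> d" for u
    using ordinal_mem[OF d that] that
  proof (induction u rule: ordinal_induct)
    case definable
    show ?case by (intro definability definable_fun_subst1[OF h])
  next
    case (ordinal u)
    show ?case
    proof (rule set_eqI)
      fix w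
      have below: "x \<epsilon> d" if "x \<epsilon> u" for x using ordinal_trans[OF d that ordinal.prems] .
      have "w \<epsilon> h u \<longleftrightarrow> (\<exists>x. x \<epsilon> d \<and> w = h x \<and> h x \<epsilon> h u)"
        using onto[of w] ordinal_trans[OF e _ into[OF ordinal.prems]] by blast
      also have "\<dots> \<longleftrightarrow> (\<exists>x. x \<epsilon> u \<and> w = h x)" using order[OF _ ordinal.prems] below by blast
      also have "\<dots> \<longleftrightarrow> w \<epsilon> u" using ordinal.IH below by auto
      finally show "w \<epsilon> h u \<longleftrightarrow> w \<epsilon> u" .
    qed
  qed
  then show "u \<epsilon> d \<Longrightarrow> h u = u" .
  show "d = e" by (rule set_eqI) (use into onto id in metis)
qed

section \<open>Natural numbers\<close>

definition natural_number :: "'a \<Rightarrow> bool" where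
  "natural_number n \<longleftrightarrow> ordinal n \<and> zero_or_suc n \<and> (\<forall>k. k \<epsilon> n \<longrightarrow> zero_or_suc k)"

lemma definable_natural_number: "class_pred natural_number"
  unfolding natural_number_def zero_or_suc_def by (intro definability)

lemma natural_number_mem: "natural_number n \<Longrightarrow> k \<epsilon> n \<Longrightarrow> natural_number k"
  unfolding natural_number_def using ordinal_mem ordinal_trans by blast

lemma natural_number_mem_inductive:
  assumes "natural_number n" and "empty \<epsilon> w" "\<And>x. x \<epsilon> w \<Longrightarrow> suc x \<epsilon> w" shows "n \<epsilon> w"
proof -
  have "ordinal n" using assms(1) unfolding natural_number_def by blast
  then show ?thesis using assms(1)
  proof (induction n rule: ordinal_induct)
    case definable
    show ?case by (intro definability definable_natural_number)
  next
    case (ordinal n)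
    then have "n = empty \<or> (\<exists>k. n = suc k)" unfolding natural_number_def zero_or_suc_def by blast
    then consider (zero) "n = empty" | (successor) k where "n = suc k" by blast
    then show ?case
    proof cases
      case successor
      then show ?thesis using ordinal.IH[of k] natural_number_mem[OF ordinal.prems] assms(3) by simp
    qed (use assms(2) in simp)
  qed
qed

lemma omega_iff: "n \<epsilon> omega \<longleftrightarrow> natural_number n"
proof -
  obtain w z where z: "z \<epsilon> w" "\<forall>u. \<not> u \<epsilon> z"
    and w: "\<And>x. x \<epsilon> w \<Longrightarrow> \<exists>y. y \<epsilon> w \<and> (\<forall>u. u \<epsilon> y \<longleftrightarrow> u \<epsilon> x \<or> u = x)"
    using ZF unfolding ZF_def infinity_def by blast
  have "empty \<epsilon> w" using z eq_empty_iff[of z] by simp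
  moreover have "suc x \<epsilon> w" if x: "x \<epsilon> w" for x
  proof -
    obtain y where y: "y \<epsilon> w" "\<And>u. u \<epsilon> y \<longleftrightarrow> u \<epsilon> x \<or> u = x" using w[OF x] by blast
    then have "y = suc x" by (intro set_eqI) simp
    then show ?thesis using y by simp
  qed
  ultimately have "natural_number n \<Longrightarrow> n \<epsilon> w" for n using natural_number_mem_inductive by blast
  then show ?thesis unfolding omega_def natural_number_def[symmetric]
    by (intro mem_SET_separation[where a = w] definable_natural_number)
qed

lemma omega_empty [simp]: "empty \<epsilon> omega"
  by (simp add: omega_iff natural_number_def ordinal_empty zero_or_suc_def)

lemma omega_mem: "n \<epsilon> omega \<Longrightarrow> k \<epsilon> n \<Longrightarrow> k \<epsilon> omega"
  unfolding omega_iff by (rule natural_number_mem)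

lemma omega_suc [simp]: "suc n \<epsilon> omega \<longleftrightarrow> n \<epsilon> omega"
proof
  assume "n \<epsilon> omega"
  then show "suc n \<epsilon> omega"
    using ordinal_suc[of n] unfolding omega_iff natural_number_def zero_or_suc_def by auto
qed (use omega_mem[of "suc n" n] in simp)

lemma ordinal_of_omega: "n \<epsilon> omega \<Longrightarrow> ordinal n"
  unfolding omega_iff natural_number_def by blast

lemma ordinal_omega: "ordinal omega"
  by (rule ordinalI) (blast intro: omega_mem ordinal_of_omega)+

lemma omega_cases:
  assumes "n \<epsilon> omega" obtains (empty) "n = empty" | (suc) k where "k \<epsilon> omega" "n = suc k"
  using assms unfolding omega_iff[of n] natural_number_def zero_or_suc_def
  by (metis assms omega_suc)

lemma omega_induct [consumes 1, case_names definable empty suc]: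
  assumes "n \<epsilon> omega" "class_pred P" "P empty" "\<And>n. n \<epsilon> omega \<Longrightarrow> P n \<Longrightarrow> P (suc n)"
  shows "P n"
  using ordinal_of_omega[OF assms(1)] assms(1)
proof (induction n rule: ordinal_induct)
  case definable
  show ?case by (intro definability assms(2))
next
  case (ordinal n)
  from ordinal.prems show ?case by (cases rule: omega_cases) (use assms(3,4) ordinal.IH in auto)
qed

lemma suc_mem_suc_iff: "n \<epsilon> omega \<Longrightarrow> suc k \<epsilon> suc n \<longleftrightarrow> k \<epsilon> n"
proof
  assume n: "n \<epsilon> omega" and "suc k \<epsilon> suc n"
  then show "k \<epsilon> n" using ordinal_trans[OF ordinal_of_omega[OF n], of k "suc k"] by auto
next
  assume n: "n \<epsilon> omega" and "k \<epsilon> n"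
  moreover from this have "ordinal (suc k)" using omega_mem ordinal_of_omega ordinal_suc by blast
  ultimately show "suc k \<epsilon> suc n"
    using ordinal_linear[of "suc k" n] ordinal_of_omega mem_asym[of k n] by auto
qed

definition omega_rec_upto :: "'a \<Rightarrow> ('a \<Rightarrow> 'a \<Rightarrow> 'a) \<Rightarrow> 'a \<Rightarrow> 'a \<Rightarrow> bool" where
  "omega_rec_upto a h n g \<longleftrightarrow> g \<cdot> empty = a \<and>
     (\<forall>k y. k \<epsilon> n \<longrightarrow> y = g \<cdot> k \<longrightarrow> g \<cdot> suc k = h k y)"

definition omega_rec :: "'a \<Rightarrow> ('a \<Rightarrow> 'a \<Rightarrow> 'a) \<Rightarrow> 'a \<Rightarrow> 'a" where
  "omega_rec a h n = the_set (\<lambda>y. \<exists>g. omega_rec_upto a h n g \<and> y = g \<cdot> n)"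

lemma definable_omega_rec [definability]:
  assumes a: "definable_fun a" and m: "definable_fun m"
    and h: "definable_fun (\<lambda>s. h (\<lambda>n. s (Suc (Suc n))) (s (Suc 0)) (s 0))"
  shows "definable_fun (\<lambda>s. omega_rec (a s) (\<lambda>k y. h s k y) (m s))"
proof -
  have "definable_fun (\<lambda>s. h (\<lambda>n. s (Suc (Suc (Suc (Suc n))))) (s (Suc 0)) (s 0))"
    using definable_fun_rename[OF h,
        of "case_nat 0 (case_nat (Suc 0) (\<lambda>n. Suc (Suc (Suc (Suc n)))))"] by simp
  then show ?thesis unfolding omega_rec_def omega_rec_upto_def
    by (intro definability definable_fun_rename[OF a] definable_fun_rename[OF m])
qed

context
  fixes h assumes h: "class_fun2 h"
begin

lemma ex_omega_rec_upto: "n \<epsilon> omega \<Longrightarrow> \<exists>g. omega_rec_upto a h n g"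
proof (induction n rule: omega_induct)
  case definable
  show ?case unfolding omega_rec_upto_def by (intro definability definable_fun_subst2[OF h])
next
  case empty
  have "lam (suc empty) (\<lambda>_. a) \<cdot> empty = a" by (rule fun_val_lam) (intro definability, simp)
  then show ?case unfolding omega_rec_upto_def by auto
next
  case (suc n)
  then obtain g where g: "g \<cdot> empty = a" "\<And>k. k \<epsilon> n \<Longrightarrow> g \<cdot> suc k = h k (g \<cdot> k)"
    unfolding omega_rec_upto_def by blast
  let ?t = "\<lambda>k. if k = suc n then h n (g \<cdot> n) else g \<cdot> k"
  let ?g = "lam (suc (suc n)) ?t"
  have val: "?g \<cdot> k = ?t k" if "k \<epsilon> suc (suc n)" for k
    by (rule fun_val_lam[OF _ that]) (intro definability)
  have neq: "k \<noteq> suc n" if "k \<epsilon> suc n" for k using that not_mem_self by metis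
  have "empty \<epsilon> suc (suc n)"
    using ordinal_linear[OF ordinal_empty, of "suc (suc n)"] ordinal_of_omega suc.hyps by simp
  then have "?g \<cdot> empty = a" using val g(1) by simp
  moreover have "?g \<cdot> suc k = h k (?g \<cdot> k)" if k: "k \<epsilon> suc n" for k
  proof (cases "k = n")
    case True then show ?thesis using val[of "suc n"] val[of n] neq[of n] by simp
  next
    case False
    then have "k \<epsilon> n" using k by simp
    moreover from this have "suc k \<epsilon> suc n" using suc_mem_suc_iff[OF suc.hyps] by simp
    ultimately show ?thesis using val[of "suc k"] val[of k] neq[of k] neq[of "suc k"] g(2) by auto
  qed
  ultimately show ?case unfolding omega_rec_upto_def by blast
qed

lemma omega_rec_upto_unique:
  assumes n: "n \<epsilon> omega" and g: "omega_rec_upto a h n g" "omega_rec_upto a h n g'"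
  shows "g \<cdot> n = g' \<cdot> n"
proof -
  have "k \<epsilon> suc n \<longrightarrow> g \<cdot> k = g' \<cdot> k" if "k \<epsilon> omega" for k
    using that
  proof (induction k rule: omega_induct)
    case definable
    show ?case by (intro definability)
  next
    case empty
    show ?case using g unfolding omega_rec_upto_def by simp
  next
    case (suc k)
    then show ?case using g suc_mem_suc_iff[OF n] unfolding omega_rec_upto_def by auto
  qed
  then show ?thesis using n by simp
qed

lemma omega_rec_eq: "n \<epsilon> omega \<Longrightarrow> omega_rec_upto a h n g \<Longrightarrow> omega_rec a h n = g \<cdot> n"
  unfolding omega_rec_def by (rule the_set_eq) (use omega_rec_upto_unique in blast)+

lemma omega_rec_empty: "omega_rec a h empty = a"
proof -
  obtain g where g: "omega_rec_upto a h empty g" using ex_omega_rec_upto omega_empty by blast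
  then show ?thesis using omega_rec_eq[OF omega_empty g] by (simp add: omega_rec_upto_def)
qed

lemma omega_rec_suc: "n \<epsilon> omega \<Longrightarrow> omega_rec a h (suc n) = h n (omega_rec a h n)"
proof -
  assume n: "n \<epsilon> omega"
  then obtain g where g: "omega_rec_upto a h (suc n) g" using ex_omega_rec_upto omega_suc by blast
  then have "omega_rec_upto a h n g" by (simp add: omega_rec_upto_def)
  then show ?thesis using omega_rec_eq[OF _ g] omega_rec_eq[of n a g] n g
    by (simp add: omega_rec_upto_def)
qed

end

definition dbl :: "'a \<Rightarrow> 'a" where
  "dbl n = omega_rec empty (\<lambda>_ y. suc (suc y)) n"

lemma definable_dbl [definability]: "definable_fun t \<Longrightarrow> definable_fun (\<lambda>s. dbl (t s))"
  by (rule definable_fun_subst1) (unfold dbl_def, intro definability)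

lemma dbl_empty [simp]: "dbl empty = empty"
  unfolding dbl_def by (rule omega_rec_empty) (intro definability)

lemma dbl_suc [simp]: "n \<epsilon> omega \<Longrightarrow> dbl (suc n) = suc (suc (dbl n))"
  unfolding dbl_def by (rule omega_rec_suc) (intro definability)

lemma dbl_omega [simp]: "n \<epsilon> omega \<Longrightarrow> dbl n \<epsilon> omega"
  by (induction n rule: omega_induct) (intro definability, simp_all)

lemma dbl_inject: "m \<epsilon> omega \<Longrightarrow> n \<epsilon> omega \<Longrightarrow> dbl m = dbl n \<Longrightarrow> m = n"
proof (induction m arbitrary: n rule: omega_induct)
  case definable
  show ?case by (intro definability)
next
  case empty
  from empty(1) show ?case by (cases rule: omega_cases) (use empty(2) in simp_all)
next
  case (suc m)
  from suc.prems(1) show ?case by (cases rule: omega_cases) (use suc in simp_all)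
qed

lemma dbl_neq_suc_dbl: "m \<epsilon> omega \<Longrightarrow> n \<epsilon> omega \<Longrightarrow> dbl m \<noteq> suc (dbl n)"
proof (induction m arbitrary: n rule: omega_induct)
  case definable
  show ?case by (intro definability)
next
  case (suc m)
  from suc.prems show ?case by (cases rule: omega_cases) (use suc in simp_all)
qed simp

lemma dbl_or_suc_dbl: "n \<epsilon> omega \<Longrightarrow> \<exists>k. k \<epsilon> omega \<and> (n = dbl k \<or> n = suc (dbl k))"
proof (induction n rule: omega_induct)
  case definable
  show ?case by (intro definability)
next
  case empty
  show ?case using dbl_empty omega_empty by metis
next
  case (suc n)
  then show ?case using dbl_suc omega_suc by metis
qed

definition half :: "'a \<Rightarrow> 'a" where
  "half n = the_set (\<lambda>k. k \<epsilon> omega \<and> (n = dbl k \<or> n = suc (dbl k)))"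

lemma definable_half [definability]: "definable_fun t \<Longrightarrow> definable_fun (\<lambda>s. half (t s))"
  by (rule definable_fun_subst1) (unfold half_def, intro definability)

lemma half_dbl [simp]: "k \<epsilon> omega \<Longrightarrow> half (dbl k) = k"
  unfolding half_def by (rule the_set_eq) (use dbl_inject dbl_neq_suc_dbl in blast)+

lemma half_suc_dbl [simp]: "k \<epsilon> omega \<Longrightarrow> half (suc (dbl k)) = k"
  unfolding half_def by (rule the_set_eq) (use dbl_inject dbl_neq_suc_dbl suc_inject in metis)+

lemma half_omega: "n \<epsilon> omega \<Longrightarrow> half n \<epsilon> omega"
  using dbl_or_suc_dbl by force

text \<open>The pairing function \<open>(m, n) \<mapsto> 2\<^sup>m (2n + 1)\<close>.\<close>

definition npair :: "'a \<Rightarrow> 'a \<Rightarrow> 'a" where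
  "npair m n = omega_rec (suc (dbl n)) (\<lambda>_ y. dbl y) m"

lemma definable_npair [definability]:
  "definable_fun t \<Longrightarrow> definable_fun u \<Longrightarrow> definable_fun (\<lambda>s. npair (t s) (u s))"
  by (rule definable_fun_subst2) (unfold npair_def, intro definability)

lemma npair_empty [simp]: "npair empty n = suc (dbl n)"
  unfolding npair_def by (rule omega_rec_empty) (intro definability)

lemma npair_suc [simp]: "m \<epsilon> omega \<Longrightarrow> npair (suc m) n = dbl (npair m n)"
  unfolding npair_def by (rule omega_rec_suc) (intro definability)

lemma npair_omega [simp]: "m \<epsilon> omega \<Longrightarrow> n \<epsilon> omega \<Longrightarrow> npair m n \<epsilon> omega"
  by (induction m rule: omega_induct) (intro definability, simp_all)

lemma npair_inject:
  assumes "m \<epsilon> omega" "m' \<epsilon> omega" and n: "n \<epsilon> omega" "n' \<epsilon> omega" and "npair m n = npair m' n'"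
  shows "m = m' \<and> n = n'"
  using assms(1,2,5)
proof (induction m arbitrary: m' rule: omega_induct)
  case definable
  show ?case by (intro definability)
next
  case empty
  note eq = empty(2)
  from empty(1) show ?case
  proof (cases rule: omega_cases)
    case empty
    then show ?thesis using eq n dbl_inject[of n n'] by simp
  next
    case (suc k)
    then show ?thesis using eq n dbl_neq_suc_dbl[of "npair k n'" n] by simp
  qed
next
  case (suc m)
  note m = suc
  from m(3) show ?case
  proof (cases rule: omega_cases)
    case empty
    then show ?thesis using m n dbl_neq_suc_dbl[of "npair m n" n'] by simp
  next
    case (suc k)
    then show ?thesis using m n dbl_inject[of "npair m n" "npair k n'"] by simp
  qed
qed

lemma alternating_sets_agree:
  assumes n: "n \<epsilon> omega" and "empty \<epsilon> e" "\<And>k. k \<epsilon> n \<Longrightarrow> suc k \<epsilon> e \<longleftrightarrow> \<not> k \<epsilon> e"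
    and "empty \<epsilon> e'" "\<And>k. k \<epsilon> n \<Longrightarrow> suc k \<epsilon> e' \<longleftrightarrow> \<not> k \<epsilon> e'"
  shows "n \<epsilon> e \<longleftrightarrow> n \<epsilon> e'"
proof -
  have "k \<epsilon> suc n \<longrightarrow> (k \<epsilon> e \<longleftrightarrow> k \<epsilon> e')" if "k \<epsilon> omega" for k
    using that
  proof (induction k rule: omega_induct)
    case definable
    show ?case by (intro definability)
  next
    case (suc k)
    then show ?case using assms(3,5) suc_mem_suc_iff[OF n] by auto
  qed (simp add: assms(2,4))
  then show ?thesis using n by simp
qed

lemma even_nat_iff:
  assumes n: "n \<epsilon> omega" shows "even_nat n \<longleftrightarrow> (\<exists>k. k \<epsilon> omega \<and> n = dbl k)"
proof -
  define e where "e = sep omega (\<lambda>n. \<exists>k. k \<epsilon> omega \<and> n = dbl k)"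
  have e: "m \<epsilon> e \<longleftrightarrow> m \<epsilon> omega \<and> (\<exists>k. k \<epsilon> omega \<and> m = dbl k)" for m
    unfolding e_def by (rule sep_iff) (intro definability)
  have e_empty: "empty \<epsilon> e" using e dbl_empty omega_empty by metis
  have e_suc: "suc k \<epsilon> e \<longleftrightarrow> \<not> k \<epsilon> e" if k: "k \<epsilon> n" for k
  proof
    assume "suc k \<epsilon> e"
    then obtain i where "i \<epsilon> omega" "suc k = dbl i" using e by blast
    then show "\<not> k \<epsilon> e" using e dbl_neq_suc_dbl[of i] by metis
  next
    assume "\<not> k \<epsilon> e"
    then obtain i where "i \<epsilon> omega" "k = suc (dbl i)"
      using e[of k] dbl_or_suc_dbl[OF omega_mem[OF n k]] omega_mem[OF n k] by blast
    then show "suc k \<epsilon> e" using e omega_mem[OF n k] dbl_suc omega_suc by metis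
  qed
  have "even_nat n \<longleftrightarrow> n \<epsilon> e"
    unfolding even_nat_def using alternating_sets_agree[OF n e_empty e_suc] e_empty e_suc by blast
  then show ?thesis using e n by blast
qed

lemma even_nat_dbl: "n \<epsilon> omega \<Longrightarrow> even_nat (dbl n)"
  using even_nat_iff by auto

lemma even_nat_empty: "even_nat empty"
  using even_nat_dbl[OF omega_empty] by simp

lemma not_even_nat_suc_dbl: "n \<epsilon> omega \<Longrightarrow> \<not> even_nat (suc (dbl n))"
  using even_nat_iff[of "suc (dbl n)"] dbl_neq_suc_dbl by auto metis

lemma definable_even_nat [definability]: "definable_fun t \<Longrightarrow> definable_pred (\<lambda>s. even_nat (t s))"
  by (rule definable_pred_subst1) (unfold even_nat_def, intro definability)

section \<open>Countable sets and reals\<close>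

definition countable :: "'a \<Rightarrow> bool" where
  "countable A \<longleftrightarrow> injects A omega"

lemma countableE:
  assumes "countable A" obtains c where "inj_from_to c A omega"
  using assms unfolding countable_def by (rule injectsE)

lemma countable_injects: "injects A B \<Longrightarrow> countable B \<Longrightarrow> countable A"
  unfolding countable_def by (rule injects_trans)

lemma countable_subset: "subset A B \<Longrightarrow> countable B \<Longrightarrow> countable A"
  by (rule countable_injects[OF subset_imp_injects])

lemma countable_omega: "countable omega"
  unfolding countable_def by (rule injects_refl)

lemma countable_product:
  assumes "countable A" "countable B" shows "countable (product A B)"
proof -
  have "injects (product A B) (product omega omega)"
    using assms unfolding countable_def by (rule injects_product_mono)
  moreover have "injects (product omega omega) omega"
  proof (rule injectsI[where t = "\<lambda>p. npair (pfst p) (psnd p)"])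
    show "class_fun (\<lambda>p. npair (pfst p) (psnd p))" by (intro definability)
    show "npair (pfst p) (psnd p) \<epsilon> omega" if "p \<epsilon> product omega omega" for p
      using that by (auto simp: product_iff)
    fix p q assume "p \<epsilon> product omega omega" "q \<epsilon> product omega omega"
      and eq: "npair (pfst p) (psnd p) = npair (pfst q) (psnd q)"
    then obtain m n m' n' where "m \<epsilon> omega" "n \<epsilon> omega" "p = opair m n"
      and "m' \<epsilon> omega" "n' \<epsilon> omega" "q = opair m' n'" unfolding product_iff by blast
    then show "p = q" using eq npair_inject[of m m' n n'] by simp
  qed
  ultimately show ?thesis unfolding countable_def by (rule injects_trans)
qed

lemma countable_disjoint_sum:
  assumes "countable A" "countable B" shows "countable (disjoint_sum A B)"
proof -
  have "injects (disjoint_sum A B) (disjoint_sum omega omega)"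
    using assms unfolding countable_def by (rule injects_disjoint_sum_mono)
  moreover have "subset (disjoint_sum omega omega) (product omega omega)"
    by (auto simp: subset_def disjoint_sum_iff)
  ultimately show ?thesis
    using countable_product countable_omega countable_subset countable_injects by blast
qed

lemma reals_iff: "x \<epsilon> reals \<longleftrightarrow> maps x omega omega"
  unfolding reals_def by (rule fun_space_iff)

lemma constant_real: "n \<epsilon> omega \<Longrightarrow> lam omega (\<lambda>_. n) \<epsilon> reals"
  unfolding reals_iff by (intro maps_lam definability)

lemma power_set_omega_injects_reals: "injects (power_set omega) reals"
proof (rule injectsI)
  let ?\<chi> = "\<lambda>S n. if n \<epsilon> S then suc empty else empty"
  have \<chi>: "class_fun (?\<chi> S)" for S by (intro definability)
  show "class_fun (\<lambda>S. lam omega (?\<chi> S))" by (intro definability)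
  show "lam omega (?\<chi> S) \<epsilon> reals" for S
    unfolding reals_iff by (rule maps_lam[OF \<chi>]) simp
  fix S T assume ST: "S \<epsilon> power_set omega" "T \<epsilon> power_set omega"
    and eq: "lam omega (?\<chi> S) = lam omega (?\<chi> T)"
  have "n \<epsilon> S \<longleftrightarrow> n \<epsilon> T" if "n \<epsilon> omega" for n
    using fun_val_lam[OF \<chi> that, of S] fun_val_lam[OF \<chi> that, of T] eq by (auto split: if_splits)
  then show "S = T" using ST by (intro set_eqI) (auto simp: subset_def)
qed

lemma power_set_injects_reals: "countable A \<Longrightarrow> injects (power_set A) reals"
  unfolding countable_def
  by (rule injects_trans[OF injects_power_set_mono power_set_omega_injects_reals])

lemma power_set_product_omega_injects_reals: "injects (power_set (product omega omega)) reals"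
  by (intro power_set_injects_reals countable_product countable_omega)

lemma reals_injects_power_set: "injects reals (power_set (product omega omega))"
  by (rule subset_imp_injects) (simp add: subset_def[of reals] reals_iff maps_subset_product)

lemma omega_injects_reals: "injects omega reals"
proof -
  have "subset omega (power_set omega)"
    unfolding subset_def[of omega] by (simp add: ordinal_mem_subset ordinal_omega)
  then show ?thesis by (rule injects_trans[OF subset_imp_injects power_set_omega_injects_reals])
qed

lemma product_injects_reals:
  assumes "injects A reals" "injects B reals" shows "injects (product A B) reals"
proof -
  let ?W = "product omega omega"
  have "injects (product A B) (product (power_set ?W) (power_set ?W))"
    by (intro injects_product_mono injects_trans[OF _ reals_injects_power_set] assms)
  moreover have "countable (disjoint_sum ?W ?W)"
    by (intro countable_disjoint_sum countable_product countable_omega)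
  ultimately show ?thesis
    using injects_product_power_set power_set_injects_reals injects_trans by blast
qed

lemma disjoint_sum_injects_reals:
  assumes "injects A reals" "injects B reals" shows "injects (disjoint_sum A B) reals"
proof -
  have "injects (disjoint_sum A B) (disjoint_sum reals reals)"
    using assms by (rule injects_disjoint_sum_mono)
  moreover have "injects (disjoint_sum reals reals) (product omega reals)"
    by (rule subset_imp_injects) (auto simp: subset_def disjoint_sum_iff)
  moreover have "injects (product omega reals) reals"
    by (intro product_injects_reals omega_injects_reals injects_refl)
  ultimately show ?thesis using injects_trans by blast
qed

section \<open>Countable ordinals and their codes\<close>

definition relabel :: "'a \<Rightarrow> 'a \<Rightarrow> 'a" where
  "relabel c r = img (\<lambda>p. opair (c \<cdot> pfst p) (c \<cdot> psnd p)) r"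

lemma definable_relabel [definability]:
  "definable_fun t \<Longrightarrow> definable_fun u \<Longrightarrow> definable_fun (\<lambda>s. relabel (t s) (u s))"
  by (rule definable_fun_subst2) (unfold relabel_def, intro definability)

lemma relabel_iff: "q \<epsilon> relabel c r \<longleftrightarrow> (\<exists>p. p \<epsilon> r \<and> q = opair (c \<cdot> pfst p) (c \<cdot> psnd p))"
  unfolding relabel_def by (rule img_iff) (intro definability)

lemma relabel_subset:
  assumes "inj_from_to c A B" "subset r (product A A)" shows "subset (relabel c r) (product B B)"
  unfolding subset_def relabel_iff
proof (intro allI impI, elim exE conjE)
  fix q p assume "p \<epsilon> r" and q: "q = opair (c \<cdot> pfst p) (c \<cdot> psnd p)"
  then have "p \<epsilon> product A A" using assms(2) unfolding subset_def by blast
  then show "q \<epsilon> product B B" using q inj_from_to_mem[OF assms(1)] by (auto simp: product_iff)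
qed

lemma opair_relabel_iff:
  assumes c: "inj_from_to c A B" and r: "subset r (product A A)" and u: "u \<epsilon> A" and v: "v \<epsilon> A"
  shows "opair (c \<cdot> u) (c \<cdot> v) \<epsilon> relabel c r \<longleftrightarrow> opair u v \<epsilon> r"
proof
  assume "opair (c \<cdot> u) (c \<cdot> v) \<epsilon> relabel c r"
  then obtain p where p: "p \<epsilon> r" "c \<cdot> u = c \<cdot> pfst p" "c \<cdot> v = c \<cdot> psnd p"
    unfolding relabel_iff by auto
  then obtain u' v' where p': "u' \<epsilon> A" "v' \<epsilon> A" "p = opair u' v'"
    using r unfolding subset_def product_iff by blast
  then have "u = u'" "v = v'" using p(2,3) inj_from_to_eq_iff[OF c] u v by auto
  then show "opair u v \<epsilon> r" using p(1) p'(3) by simp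
next
  assume "opair u v \<epsilon> r"
  then show "opair (c \<cdot> u) (c \<cdot> v) \<epsilon> relabel c r"
    unfolding relabel_iff by (intro exI[of _ "opair u v"]) simp
qed

lemma relabel_inject:
  assumes c: "inj_from_to c A B" and r: "subset r (product A A)" "subset r' (product A A)"
    and eq: "relabel c r = relabel c r'"
  shows "r = r'"
proof (rule set_eqI)
  fix p
  have "opair u v \<epsilon> r \<longleftrightarrow> opair u v \<epsilon> r'" if "u \<epsilon> A" "v \<epsilon> A" for u v
    using opair_relabel_iff[OF c r(1) that] opair_relabel_iff[OF c r(2) that] eq by simp
  moreover have "p \<epsilon> r \<or> p \<epsilon> r' \<Longrightarrow> p \<epsilon> product A A" using r unfolding subset_def by blast
  ultimately show "p \<epsilon> r \<longleftrightarrow> p \<epsilon> r'" unfolding product_iff by blast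
qed

text \<open>The order is taken reflexive so that its field is all of \<open>d\<close>, also when \<open>d = 1\<close>.\<close>

definition order_rel :: "'a \<Rightarrow> 'a" where
  "order_rel d = sep (product d d) (\<lambda>p. pfst p \<epsilon> psnd p \<or> pfst p = psnd p)"

lemma definable_order_rel [definability]:
  "definable_fun t \<Longrightarrow> definable_fun (\<lambda>s. order_rel (t s))"
  by (rule definable_fun_subst1) (unfold order_rel_def, intro definability)

lemma order_rel_iff: "p \<epsilon> order_rel d \<longleftrightarrow> p \<epsilon> product d d \<and> (pfst p \<epsilon> psnd p \<or> pfst p = psnd p)"
  unfolding order_rel_def by (rule sep_iff) (intro definability)

lemma order_rel_subset: "subset (order_rel d) (product d d)"
  unfolding subset_def order_rel_iff by blast

definition code :: "'a \<Rightarrow> 'a \<Rightarrow> 'a" where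
  "code d c = relabel c (order_rel d)"

lemma definable_code [definability]:
  "definable_fun t \<Longrightarrow> definable_fun u \<Longrightarrow> definable_fun (\<lambda>s. code (t s) (u s))"
  by (rule definable_fun_subst2) (unfold code_def, intro definability)

lemma code_subset: "inj_from_to c d B \<Longrightarrow> subset (code d c) (product B B)"
  unfolding code_def by (rule relabel_subset[OF _ order_rel_subset])

lemma opair_code_iff:
  "inj_from_to c d B \<Longrightarrow> u \<epsilon> d \<Longrightarrow> v \<epsilon> d \<Longrightarrow> opair (c \<cdot> u) (c \<cdot> v) \<epsilon> code d c \<longleftrightarrow> u \<epsilon> v \<or> u = v"
  unfolding code_def by (simp add: opair_relabel_iff[OF _ order_rel_subset] order_rel_iff)

lemma diagonal_code_mem: "opair n n \<epsilon> code d c \<Longrightarrow> \<exists>u. u \<epsilon> d \<and> n = c \<cdot> u"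
  unfolding code_def relabel_iff order_rel_iff product_iff by auto

lemma code_inject:
  assumes d: "ordinal d" and c: "inj_from_to c d B"
    and d': "ordinal d'" and c': "inj_from_to c' d' B"
    and eq: "code d c = code d' c'"
  shows "d = d' \<and> c = c'"
proof -
  define h where "h u = fun_inv c' d' (c \<cdot> u)" for u
  have h: "h u \<epsilon> d'" "c' \<cdot> h u = c \<cdot> u" if u: "u \<epsilon> d" for u
  proof -
    have "opair (c \<cdot> u) (c \<cdot> u) \<epsilon> code d' c'" using opair_code_iff[OF c u u] eq by simp
    then obtain u' where "u' \<epsilon> d'" "c \<cdot> u = c' \<cdot> u'" using diagonal_code_mem by blast
    then show "h u \<epsilon> d'" "c' \<cdot> h u = c \<cdot> u" unfolding h_def using fun_inv_fun_val[OF c'] by simp_all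
  qed
  have onto: "\<exists>u. u \<epsilon> d \<and> v = h u" if v: "v \<epsilon> d'" for v
  proof -
    have "opair (c' \<cdot> v) (c' \<cdot> v) \<epsilon> code d c" using opair_code_iff[OF c' v v] eq by simp
    then obtain u where "u \<epsilon> d" "c' \<cdot> v = c \<cdot> u" using diagonal_code_mem by blast
    then show ?thesis unfolding h_def using fun_inv_fun_val[OF c' v] by metis
  qed
  have order: "h u \<epsilon> h v \<longleftrightarrow> u \<epsilon> v" if u: "u \<epsilon> d" and v: "v \<epsilon> d" for u v
  proof -
    have "h u \<epsilon> h v \<or> h u = h v \<longleftrightarrow> u \<epsilon> v \<or> u = v"
      using opair_code_iff[OF c u v] opair_code_iff[OF c' h(1)[OF u] h(1)[OF v]] h(2) u v eq by simp
    moreover have "h u = h v \<longleftrightarrow> u = v" using h(2) u v inj_from_to_eq_iff[OF c u v] by metis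
    ultimately show ?thesis using not_mem_self by metis
  qed
  have "class_fun h" unfolding h_def by (intro definability)
  note rigid = ordinal_isomorphism_identity[OF d d' this h(1) onto order]
  have "c = c'"
  proof (rule fun_on_eqI)
    show "fun_on c d" "fun_on c' d" using c c' rigid(1) inj_from_to_fun_on by blast+
  qed (use h(2) rigid(2) in auto)
  then show ?thesis using rigid(1) by blast
qed

definition order_type :: "'a \<Rightarrow> 'a" where
  "order_type r = the_set (\<lambda>d. ordinal d \<and> (\<exists>c. inj_from_to c d omega \<and> r = code d c))"

lemma definable_order_type [definability]:
  "definable_fun t \<Longrightarrow> definable_fun (\<lambda>s. order_type (t s))"
  by (rule definable_fun_subst1) (unfold order_type_def, intro definability)

lemma order_type_code: "ordinal d \<Longrightarrow> inj_from_to c d omega \<Longrightarrow> order_type (code d c) = d"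
  unfolding order_type_def by (rule the_set_eq) (use code_inject in blast)+

lemma omega1_iff: "a \<epsilon> omega1 \<longleftrightarrow> ordinal a \<and> countable a"
  unfolding omega1_def countable_def
proof (rule mem_SET_separation)
  show "class_pred (\<lambda>a. ordinal a \<and> injects a omega)" by (intro definability)
  fix d assume d: "ordinal d \<and> injects d omega"
  then obtain c where c: "inj_from_to c d omega" using injectsE by blast
  then have "order_type (code d c) = d" "code d c \<epsilon> power_set (product omega omega)"
    using d order_type_code code_subset by simp_all
  moreover have "class_fun order_type" by (intro definability)
  ultimately show "d \<epsilon> img order_type (power_set (product omega omega))" using img_iff by metis
qed

lemma ordinal_of_omega1: "a \<epsilon> omega1 \<Longrightarrow> ordinal a"
  by (simp add: omega1_iff)

lemma countable_of_omega1: "a \<epsilon> omega1 \<Longrightarrow> countable a"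
  by (simp add: omega1_iff)

lemma ordinal_omega1: "ordinal omega1"
proof (rule ordinalI)
  fix x y assume x: "x \<epsilon> omega1" and y: "y \<epsilon> x"
  then show "y \<epsilon> omega1"
    using ordinal_mem ordinal_mem_subset countable_subset unfolding omega1_iff by blast
qed (rule ordinal_of_omega1)

lemma omega1_empty [simp]: "empty \<epsilon> omega1"
  unfolding omega1_iff countable_def
  by (simp add: ordinal_empty subset_imp_injects subset_def)

lemma omega1_suc:
  assumes "a \<epsilon> omega1" shows "suc a \<epsilon> omega1"
proof -
  obtain c where c: "inj_from_to c a omega"
    using countable_of_omega1[OF assms] by (rule countableE)
  have "countable (suc a)" unfolding countable_def
  proof (rule injectsI[where t = "\<lambda>x. if x = a then empty else suc (c \<cdot> x)"])
    show "class_fun (\<lambda>x. if x = a then empty else suc (c \<cdot> x))" by (intro definability)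
  qed (auto simp: inj_from_to_mem[OF c] inj_from_to_eq_iff[OF c] split: if_splits)
  then show ?thesis using ordinal_suc[OF ordinal_of_omega1[OF assms]] unfolding omega1_iff by blast
qed

lemma omega1_upper_bound:
  assumes "a \<epsilon> omega1" "b \<epsilon> omega1"
  obtains d where "d \<epsilon> omega1" "subset a d" "subset b d"
proof -
  consider "subset a b" | "subset b a"
    using ordinal_linear[of a b] ordinal_mem_subset ordinal_of_omega1 assms
    unfolding subset_def by blast
  then show ?thesis by cases (use that assms in \<open>auto simp: subset_def\<close>)
qed

lemma reals_onto_omega1:
  obtains K where "class_fun K" "\<And>a. a \<epsilon> omega1 \<Longrightarrow> \<exists>x. x \<epsilon> reals \<and> K x = a"
proof -
  let ?W = "power_set (product omega omega)"
  obtain e where e: "inj_from_to e ?W reals"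
    using power_set_product_omega_injects_reals by (rule injectsE)
  have onto: "\<exists>x. x \<epsilon> reals \<and> order_type (fun_inv e ?W x) = a" if a: "a \<epsilon> omega1" for a
  proof -
    obtain c where c: "inj_from_to c a omega"
      using countable_of_omega1[OF a] by (rule countableE)
    then have "code a c \<epsilon> ?W" using code_subset by simp
    then show ?thesis
      using inj_from_to_mem[OF e] fun_inv_fun_val[OF e]
        order_type_code[OF ordinal_of_omega1[OF a] c] by metis
  qed
  have "class_fun (\<lambda>x. order_type (fun_inv e ?W x))" by (intro definability)
  then show ?thesis by (rule that[OF _ onto])
qed

definition bounded :: "'a \<Rightarrow> bool" where
  "bounded f \<longleftrightarrow> (\<exists>d. d \<epsilon> omega1 \<and> subset f (product d d))"

definition bound :: "'a \<Rightarrow> 'a" where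
  "bound f = least_ordinal (\<lambda>d. d \<epsilon> omega1 \<and> subset f (product d d))"

lemma definable_bound [definability]: "definable_fun t \<Longrightarrow> definable_fun (\<lambda>s. bound (t s))"
  by (rule definable_fun_subst1) (unfold bound_def, intro definability)

lemma bound:
  assumes "bounded f" shows "bound f \<epsilon> omega1" "subset f (product (bound f) (bound f))"
proof -
  let ?P = "\<lambda>d. d \<epsilon> omega1 \<and> subset f (product d d)"
  obtain d where "?P d" using assms bounded_def by blast
  moreover have "class_pred ?P" by (intro definability)
  ultimately have "?P (bound f)"
    unfolding bound_def using least_ordinal[of ?P d] ordinal_of_omega1 by blast
  then show "bound f \<epsilon> omega1" "subset f (product (bound f) (bound f))" by blast+
qed

lemma power_set_bounded_injects_reals:
  "d \<epsilon> omega1 \<Longrightarrow> injects (power_set (product d d)) reals"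
  by (intro power_set_injects_reals countable_product countable_of_omega1)

text \<open>If \<open>f \<subseteq> d \<times> d\<close>, the pair \<open>(code d c, relabel c f)\<close> determines first \<open>d\<close> and \<open>c\<close>, then \<open>f\<close>.\<close>

lemma reals_onto_bounded:
  obtains K where "class_fun K" "\<And>f. bounded f \<Longrightarrow> \<exists>x. x \<epsilon> reals \<and> K x = f"
proof -
  let ?W = "power_set (product omega omega)"
  have "injects (product ?W ?W) reals"
    by (intro product_injects_reals power_set_product_omega_injects_reals)
  then obtain e where e: "inj_from_to e (product ?W ?W) reals" by (rule injectsE)
  let ?coded = "\<lambda>x f d c. ordinal d \<and> inj_from_to c d omega \<and> subset f (product d d) \<and>
      x = e \<cdot> opair (code d c) (relabel c f)"
  let ?K = "\<lambda>x. the_set (\<lambda>f. \<exists>d c. ?coded x f d c)"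
  have in_W: "opair (code d c) (relabel c f) \<epsilon> product ?W ?W"
    if "inj_from_to c d omega" "subset f (product d d)" for d c f
    using that code_subset relabel_subset by simp
  have unique: "g = f" if f: "?coded x f d c" and g: "?coded x g d' c'" for x f g d d' c c'
  proof -
    have "opair (code d c) (relabel c f) = opair (code d' c') (relabel c' g)"
      using inj_from_to_eq_iff[OF e in_W in_W] f g by metis
    then have eq: "code d c = code d' c'" "relabel c f = relabel c' g" by auto
    then have "d = d' \<and> c = c'" using code_inject f g by blast
    then have "subset g (product d d)" "relabel c g = relabel c f" using g eq(2) by simp_all
    then show ?thesis using relabel_inject f by blast
  qed
  have onto: "\<exists>x. x \<epsilon> reals \<and> ?K x = f" if f: "bounded f" for f
  proof -
    obtain d where d: "d \<epsilon> omega1" "subset f (product d d)" using f bounded_def by blast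
    obtain c where c: "inj_from_to c d omega"
      using countable_of_omega1[OF d(1)] by (rule countableE)
    let ?x = "e \<cdot> opair (code d c) (relabel c f)"
    have coded: "?coded ?x f d c" using c d ordinal_of_omega1 by blast
    have "?K ?x = f" by (rule the_set_eq) (use coded unique[OF coded] in blast)+
    then show ?thesis using inj_from_to_mem[OF e in_W[OF c d(2)]] by blast
  qed
  have "class_fun ?K" by (intro definability)
  then show ?thesis by (rule that[OF _ onto])
qed

section \<open>Countable choice for sets of reals\<close>

definition countable_choice_reals :: bool where
  "countable_choice_reals \<longleftrightarrow> (\<forall>A. (\<forall>n. n \<epsilon> omega \<longrightarrow> (\<exists>x. x \<epsilon> reals \<and> x \<epsilon> A \<cdot> n)) \<longrightarrow>
     (\<exists>C. \<forall>n. n \<epsilon> omega \<longrightarrow> C \<cdot> n \<epsilon> reals \<and> C \<cdot> n \<epsilon> A \<cdot> n))"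

lemma countable_choice:
  assumes CC: countable_choice_reals and a: "countable a" and P: "class_rel P"
    and ex: "\<And>b. b \<epsilon> a \<Longrightarrow> \<exists>x. x \<epsilon> reals \<and> P b x"
  obtains C where "\<And>b. b \<epsilon> a \<Longrightarrow> P b (C \<cdot> b)"
proof -
  note [definability] = definable_pred_subst2[OF P]
  obtain c where c: "inj_from_to c a omega" using a by (rule countableE)
  define S where "S n = sep reals (\<lambda>x. \<forall>b. b \<epsilon> a \<longrightarrow> c \<cdot> b = n \<longrightarrow> P b x)" for n
  have S: "x \<epsilon> S n \<longleftrightarrow> x \<epsilon> reals \<and> (\<forall>b. b \<epsilon> a \<longrightarrow> c \<cdot> b = n \<longrightarrow> P b x)" for x n
    unfolding S_def by (rule sep_iff) (intro definability)
  have "class_fun S" unfolding S_def by (intro definability)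
  note S_val = fun_val_lam[OF this]
  have "\<exists>x. x \<epsilon> S n" for n
  proof (cases "\<exists>b. b \<epsilon> a \<and> c \<cdot> b = n")
    case True
    then obtain b where b: "b \<epsilon> a" "c \<cdot> b = n" by blast
    obtain x where "x \<epsilon> reals" "P b x" using ex[OF b(1)] by blast
    then have "x \<epsilon> S n" using S b inj_from_to_eq_iff[OF c _ b(1)] by auto
    then show ?thesis by blast
  next
    case False
    then show ?thesis using S constant_real[OF omega_empty] by blast
  qed
  then have "\<exists>x. x \<epsilon> reals \<and> x \<epsilon> lam omega S \<cdot> n" if "n \<epsilon> omega" for n
    using S S_val[OF that] by auto
  then obtain C where C: "\<And>n. n \<epsilon> omega \<Longrightarrow> C \<cdot> n \<epsilon> S n"
    using CC S_val unfolding countable_choice_reals_def by metis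
  have t: "class_fun (\<lambda>b. C \<cdot> (c \<cdot> b))" by (intro definability)
  have "P b (lam a (\<lambda>b. C \<cdot> (c \<cdot> b)) \<cdot> b)" if "b \<epsilon> a" for b
    using C[OF inj_from_to_mem[OF c that]] S that fun_val_lam[OF t that] by simp
  then show ?thesis by (rule that)
qed

lemma choose_enumerations:
  assumes CC: countable_choice_reals and a: "countable a"
    and t: "class_fun t" and t_omega1: "\<And>b. b \<epsilon> a \<Longrightarrow> t b \<epsilon> omega1"
  obtains N where "\<And>b. b \<epsilon> a \<Longrightarrow> inj_from_to (N \<cdot> b) (t b) omega"
proof -
  note [definability] = definable_fun_subst1[OF t]
  let ?W = "power_set (product omega omega)"
  obtain e where e: "inj_from_to e ?W reals"
    using power_set_product_omega_injects_reals by (rule injectsE)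
  let ?P = "\<lambda>b x. \<exists>c. inj_from_to c (t b) omega \<and> x = e \<cdot> code (t b) c"
  have "class_rel ?P" by (intro definability)
  moreover have "\<exists>x. x \<epsilon> reals \<and> ?P b x" if b: "b \<epsilon> a" for b
  proof -
    obtain c where c: "inj_from_to c (t b) omega"
      using countable_of_omega1[OF t_omega1[OF b]] by (rule countableE)
    then have "e \<cdot> code (t b) c \<epsilon> reals" using inj_from_to_mem[OF e] code_subset by simp
    then show ?thesis using c by blast
  qed
  ultimately obtain C where C: "\<And>b. b \<epsilon> a \<Longrightarrow> ?P b (C \<cdot> b)"
    by (rule countable_choice[OF CC a]) blast+
  define enum where
    "enum b = the_set (\<lambda>c. inj_from_to c (t b) omega \<and> C \<cdot> b = e \<cdot> code (t b) c)" for b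
  have enum: "inj_from_to (enum b) (t b) omega" if b: "b \<epsilon> a" for b
  proof -
    obtain c where c: "inj_from_to c (t b) omega" "C \<cdot> b = e \<cdot> code (t b) c" using C[OF b] by blast
    have "enum b = c" unfolding enum_def
    proof (rule the_set_eq)
      fix c' assume c': "inj_from_to c' (t b) omega \<and> C \<cdot> b = e \<cdot> code (t b) c'"
      then have "e \<cdot> code (t b) c' = e \<cdot> code (t b) c" using c(2) by metis
      moreover have "code (t b) c' \<epsilon> ?W" "code (t b) c \<epsilon> ?W" using c(1) c' code_subset by auto
      ultimately have "code (t b) c' = code (t b) c" using inj_from_to_eq_iff[OF e] by blast
      then show "c' = c" using code_inject ordinal_of_omega1[OF t_omega1[OF b]] c(1) c' by blast
    qed (use c in blast)
    then show ?thesis using c(1) by simp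
  qed
  have "class_fun enum" unfolding enum_def by (intro definability)
  then have "inj_from_to (lam a enum \<cdot> b) (t b) omega" if "b \<epsilon> a" for b
    using fun_val_lam enum that by simp
  then show ?thesis by (rule that)
qed

lemma countable_UN_enumerated:
  assumes a: "ordinal a" "countable a" and t: "class_fun t"
    and N: "\<And>b. b \<epsilon> a \<Longrightarrow> inj_from_to (N \<cdot> b) (t b) omega"
    and u: "\<And>z. z \<epsilon> u \<longleftrightarrow> (\<exists>b. b \<epsilon> a \<and> z \<epsilon> t b)"
  shows "countable u"
proof -
  note [definability] = definable_fun_subst1[OF t]
  define \<beta> where "\<beta> x = least_ordinal (\<lambda>b. b \<epsilon> a \<and> x \<epsilon> t b)" for x
  have \<beta>: "\<beta> x \<epsilon> a" "x \<epsilon> t (\<beta> x)" if x: "x \<epsilon> u" for x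
  proof -
    obtain b where b: "b \<epsilon> a \<and> x \<epsilon> t b" using x u by blast
    have "class_pred (\<lambda>b. b \<epsilon> a \<and> x \<epsilon> t b)" by (intro definability)
    then have "\<beta> x \<epsilon> a \<and> x \<epsilon> t (\<beta> x)"
      unfolding \<beta>_def by (rule least_ordinal[where a = b]) (use b ordinal_mem[OF a(1)] in blast)+
    then show "\<beta> x \<epsilon> a" "x \<epsilon> t (\<beta> x)" by blast+
  qed
  have "injects u (product a omega)"
  proof (rule injectsI[where t = "\<lambda>x. opair (\<beta> x) (N \<cdot> \<beta> x \<cdot> x)"])
    show "class_fun (\<lambda>x. opair (\<beta> x) (N \<cdot> \<beta> x \<cdot> x))" unfolding \<beta>_def by (intro definability)
    show "opair (\<beta> x) (N \<cdot> \<beta> x \<cdot> x) \<epsilon> product a omega" if "x \<epsilon> u" for x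
      using \<beta>[OF that] inj_from_to_mem[OF N] by simp
    show "x = y" if "x \<epsilon> u" "y \<epsilon> u" "opair (\<beta> x) (N \<cdot> \<beta> x \<cdot> x) = opair (\<beta> y) (N \<cdot> \<beta> y \<cdot> y)" for x y
      using that \<beta>[OF that(1)] \<beta>[OF that(2)] inj_from_to_eq_iff[OF N, of "\<beta> x" x y] by auto
  qed
  then show ?thesis using countable_injects countable_product[OF a(2) countable_omega] by blast
qed

lemma omega1_regular:
  assumes CC: countable_choice_reals and a: "a \<epsilon> omega1"
    and t: "class_fun t" and t_omega1: "\<And>b. b \<epsilon> a \<Longrightarrow> t b \<epsilon> omega1"
  obtains u where "u \<epsilon> omega1" "\<And>b. b \<epsilon> a \<Longrightarrow> subset (t b) u"
proof -
  obtain N where N: "\<And>b. b \<epsilon> a \<Longrightarrow> inj_from_to (N \<cdot> b) (t b) omega"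
    using choose_enumerations[OF CC countable_of_omega1[OF a] t t_omega1] by blast
  obtain u where u: "\<And>z. z \<epsilon> u \<longleftrightarrow> (\<exists>b. b \<epsilon> a \<and> z \<epsilon> t b)"
    using is_set_UN[OF t, of a] unfolding is_set_def by blast
  have "countable u"
    by (rule countable_UN_enumerated[OF _ _ t N u]) (use a omega1_iff in blast)+
  moreover have "ordinal u" by (rule ordinal_UN[OF u]) (use t_omega1 ordinal_of_omega1 in blast)
  moreover have "subset (t b) u" if "b \<epsilon> a" for b using u that unfolding subset_def by blast
  ultimately show ?thesis using that omega1_iff by blast
qed

subsection \<open>Countable choice from dependent choice\<close>

lemma dependent_choice:
  assumes DC: DC_reals and D: "injects D reals" "d \<epsilon> D" and R: "class_rel R"
    and total: "\<And>x. x \<epsilon> D \<Longrightarrow> \<exists>y. y \<epsilon> D \<and> R x y"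
  obtains f where "\<And>n. n \<epsilon> omega \<Longrightarrow> f \<cdot> n \<epsilon> D" "\<And>n. n \<epsilon> omega \<Longrightarrow> R (f \<cdot> n) (f \<cdot> suc n)"
proof -
  note [definability] = definable_pred_subst2[OF R]
  obtain e where e: "inj_from_to e D reals" using D(1) by (rule injectsE)
  let ?S = "\<lambda>x z. \<exists>y. y \<epsilon> D \<and> z = e \<cdot> y \<and> (\<forall>w. w \<epsilon> D \<longrightarrow> x = e \<cdot> w \<longrightarrow> R w y)"
  have S: "p \<epsilon> sep (product reals reals) (\<lambda>p. ?S (pfst p) (psnd p)) \<longleftrightarrow>
      p \<epsilon> product reals reals \<and> ?S (pfst p) (psnd p)" for p
    by (rule sep_iff) (intro definability)
  have "\<exists>z. z \<epsilon> reals \<and> ?S x z" for x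
  proof (cases "\<exists>w. w \<epsilon> D \<and> x = e \<cdot> w")
    case True
    then obtain w where w: "w \<epsilon> D" "x = e \<cdot> w" by blast
    then obtain y where y: "y \<epsilon> D" "R w y" using total by blast
    then have "?S x (e \<cdot> y)" using w inj_from_to_eq_iff[OF e w(1)] by auto
    then show ?thesis using inj_from_to_mem[OF e y(1)] by blast
  next
    case False
    then show ?thesis using D(2) inj_from_to_mem[OF e D(2)] by blast
  qed
  then obtain f where f: "maps f omega reals" "\<And>n. n \<epsilon> omega \<Longrightarrow> ?S (app f n) (app f (suc n))"
    using DC[unfolded DC_reals_def, rule_format,
        of "sep (product reals reals) (\<lambda>p. ?S (pfst p) (psnd p))"] unfolding S by auto
  define g where "g n = fun_inv e D (f \<cdot> suc n)" for n
  have g: "g n \<epsilon> D" "f \<cdot> suc n = e \<cdot> g n" if "n \<epsilon> omega" for n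
    using f(2)[OF that] maps_app[OF f(1)] fun_inv_fun_val[OF e] that unfolding g_def by auto
  have "R (g n) (g (suc n))" if n: "n \<epsilon> omega" for n
  proof -
    have "?S (f \<cdot> suc n) (f \<cdot> suc (suc n))" using f(2)[of "suc n"] maps_app[OF f(1)] n by simp
    then obtain y where y: "y \<epsilon> D" "e \<cdot> g (suc n) = e \<cdot> y" "R (g n) y"
      using g[OF n] g(2)[of "suc n"] n by auto
    then show ?thesis using inj_from_to_eq_iff[OF e g(1)[of "suc n"] y(1)] n by simp
  qed
  moreover have "class_fun g" unfolding g_def by (intro definability)
  ultimately show ?thesis using that[of "lam omega g"] fun_val_lam[of g] g(1) by simp
qed

lemma finite_choice:
  assumes A: "\<And>i. i \<epsilon> omega \<Longrightarrow> \<exists>x. x \<epsilon> A \<cdot> i" and n: "n \<epsilon> omega"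
  shows "\<exists>g. \<forall>i. i \<epsilon> n \<longrightarrow> g \<cdot> i \<epsilon> A \<cdot> i"
  using n
proof (induction n rule: omega_induct)
  case definable
  show ?case by (intro definability)
next
  case (suc n)
  then obtain g where g: "\<And>i. i \<epsilon> n \<Longrightarrow> g \<cdot> i \<epsilon> A \<cdot> i" by blast
  obtain x where x: "x \<epsilon> A \<cdot> n" using A[OF suc.hyps] by blast
  have "class_fun (\<lambda>i. if i = n then x else g \<cdot> i)" by (intro definability)
  note val = fun_val_lam[OF this, where A = "suc n"]
  show ?case
    by (rule exI[of _ "lam (suc n) (\<lambda>i. if i = n then x else g \<cdot> i)"]) (use val x g in auto)
qed simp

lemma successor_sequence_onto:
  assumes h: "class_fun h" and start: "h empty \<epsilon> omega"
    and step: "\<And>n. n \<epsilon> omega \<Longrightarrow> h (suc n) = suc (h n)" and "i \<epsilon> omega" "\<not> i \<epsilon> h empty"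
  shows "\<exists>n. n \<epsilon> omega \<and> h n = i"
  using assms(4,5)
proof (induction i rule: omega_induct)
  case definable
  show ?case by (intro definability definable_fun_subst1[OF h])
next
  case empty
  then have "h empty = empty"
    using ordinal_linear[OF ordinal_empty ordinal_of_omega[OF start]] by auto
  then show ?case using omega_empty by blast
next
  case (suc i)
  then consider (first) "h empty = suc i" | (later) "\<not> i \<epsilon> h empty"
    using ordinal_linear[of "suc i" "h empty"] ordinal_of_omega start
    by (metis omega_suc suc_iff mem_asym)
  then show ?case
  proof cases
    case first then show ?thesis using omega_empty by blast
  next
    case later
    then obtain n where "n \<epsilon> omega" "h n = i" using suc.IH by blast
    then show ?thesis using step omega_suc by metis
  qed
qed

text \<open>Dependent choice is applied to the pairs \<open>(n, y)\<close> with \<open>y\<close> in \<open>A n\<close>. The sequence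
  obtained may start at any \<open>k\<close>, so finitely many choices have to be supplied separately.\<close>

lemma DC_imp_countable_choice_tail:
  assumes DC: DC_reals and A: "\<And>n. n \<epsilon> omega \<Longrightarrow> \<exists>x. x \<epsilon> reals \<and> x \<epsilon> A \<cdot> n"
  obtains k C where "k \<epsilon> omega" "class_fun C"
    "\<And>i. i \<epsilon> omega \<Longrightarrow> \<not> i \<epsilon> k \<Longrightarrow> C i \<epsilon> reals \<and> C i \<epsilon> A \<cdot> i"
proof -
  define D where "D = sep (product omega reals) (\<lambda>p. psnd p \<epsilon> A \<cdot> pfst p)"
  have D: "p \<epsilon> D \<longleftrightarrow> p \<epsilon> product omega reals \<and> psnd p \<epsilon> A \<cdot> pfst p" for p
    unfolding D_def by (rule sep_iff) (intro definability)
  have D_ex: "\<exists>y. opair n y \<epsilon> D" if "n \<epsilon> omega" for n using A[OF that] that unfolding D by auto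
  have D_fst: "pfst p \<epsilon> omega" if "p \<epsilon> D" for p using that unfolding D product_iff by auto
  obtain y where y: "opair empty y \<epsilon> D" using D_ex omega_empty by blast
  have "subset D (product omega reals)" unfolding subset_def D by blast
  then have "injects D reals"
    by (rule injects_trans[OF subset_imp_injects
          product_injects_reals[OF omega_injects_reals injects_refl]])
  moreover have "class_rel (\<lambda>p q. pfst q = suc (pfst p))" by (intro definability)
  moreover have "\<exists>q. q \<epsilon> D \<and> pfst q = suc (pfst p)" if "p \<epsilon> D" for p
    using D_ex[of "suc (pfst p)"] D_fst[OF that] by (metis omega_suc pfst_opair)
  ultimately obtain f where f: "\<And>n. n \<epsilon> omega \<Longrightarrow> f \<cdot> n \<epsilon> D"
      and f_suc: "\<And>n. n \<epsilon> omega \<Longrightarrow> pfst (f \<cdot> suc n) = suc (pfst (f \<cdot> n))"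
    by (rule dependent_choice[OF DC _ y, where R = "\<lambda>p q. pfst q = suc (pfst p)"]) blast+
  define k where "k = pfst (f \<cdot> empty)"
  have k: "k \<epsilon> omega" using f D_fst omega_empty unfolding k_def by blast
  have indices: "class_fun (\<lambda>n. pfst (f \<cdot> n))" by (intro definability)
  have reached: "\<exists>n. n \<epsilon> omega \<and> pfst (f \<cdot> n) = i" if "i \<epsilon> omega" "\<not> i \<epsilon> k" for i
    by (rule successor_sequence_onto[OF indices _ f_suc]) (use that k k_def in simp_all)
  define C where "C i = psnd (f \<cdot> least_ordinal (\<lambda>n. n \<epsilon> omega \<and> pfst (f \<cdot> n) = i))" for i
  have "C i \<epsilon> reals \<and> C i \<epsilon> A \<cdot> i" if i: "i \<epsilon> omega" "\<not> i \<epsilon> k" for i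
  proof -
    let ?P = "\<lambda>n. n \<epsilon> omega \<and> pfst (f \<cdot> n) = i"
    obtain n where "?P n" using reached[OF i] by blast
    moreover have "class_pred ?P" by (intro definability)
    ultimately have "?P (least_ordinal ?P)"
      using least_ordinal[of ?P n] ordinal_of_omega by blast
    then show ?thesis using f[of "least_ordinal ?P"] unfolding C_def D product_iff by auto
  qed
  moreover have "class_fun C" unfolding C_def by (intro definability)
  ultimately show ?thesis using that k by blast
qed

lemma DC_imp_countable_choice:
  assumes DC_reals shows countable_choice_reals
  unfolding countable_choice_reals_def
proof (intro allI impI)
  fix A assume "\<forall>n. n \<epsilon> omega \<longrightarrow> (\<exists>x. x \<epsilon> reals \<and> x \<epsilon> A \<cdot> n)"
  then have A: "\<And>n. n \<epsilon> omega \<Longrightarrow> \<exists>x. x \<epsilon> reals \<and> x \<epsilon> A \<cdot> n" by blast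
  obtain k C where k: "k \<epsilon> omega" and C: "class_fun C"
    and tail: "\<And>i. i \<epsilon> omega \<Longrightarrow> \<not> i \<epsilon> k \<Longrightarrow> C i \<epsilon> reals \<and> C i \<epsilon> A \<cdot> i"
    using DC_imp_countable_choice_tail[OF assms A] by blast
  define S where "S n = sep reals (\<lambda>x. x \<epsilon> A \<cdot> n)" for n
  have S: "x \<epsilon> S n \<longleftrightarrow> x \<epsilon> reals \<and> x \<epsilon> A \<cdot> n" for x n
    unfolding S_def by (rule sep_iff) (intro definability)
  have "class_fun S" unfolding S_def by (intro definability)
  note S_val = fun_val_lam[OF this]
  have "\<exists>g. \<forall>i. i \<epsilon> k \<longrightarrow> g \<cdot> i \<epsilon> lam omega S \<cdot> i"
    by (rule finite_choice[OF _ k]) (use A S S_val in auto)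
  then obtain g where g: "\<And>i. i \<epsilon> k \<Longrightarrow> g \<cdot> i \<epsilon> S i" using S_val omega_mem[OF k] by metis
  have "class_fun (\<lambda>i. if i \<epsilon> k then g \<cdot> i else C i)" by (intro definability C)
  note val = fun_val_lam[OF this, where A = omega]
  show "\<exists>C. \<forall>n. n \<epsilon> omega \<longrightarrow> C \<cdot> n \<epsilon> reals \<and> C \<cdot> n \<epsilon> A \<cdot> n"
    by (rule exI[of _ "lam omega (\<lambda>i. if i \<epsilon> k then g \<cdot> i else C i)"]) (use val g S tail in auto)
qed

subsection \<open>Countable choice from determinacy\<close>

text \<open>Course-of-values recursion: \<open>course_rec H\<close> is the sequence whose \<open>n\<close>-th term is \<open>H n s\<close> for
  the finite sequence \<open>s\<close> of the terms before it.\<close>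

definition history :: "('a \<Rightarrow> 'a \<Rightarrow> 'a) \<Rightarrow> 'a \<Rightarrow> 'a" where
  "history H n = omega_rec empty (\<lambda>k g. un g (upair (opair k (H k g)) (opair k (H k g)))) n"

definition course_rec :: "('a \<Rightarrow> 'a \<Rightarrow> 'a) \<Rightarrow> 'a" where
  "course_rec H = lam omega (\<lambda>n. H n (history H n))"

context
  fixes H A assumes H: "class_fun2 H"
    and H_mem: "\<And>n g. n \<epsilon> omega \<Longrightarrow> maps g n A \<Longrightarrow> H n g \<epsilon> A"
begin

lemma class_fun_history: "class_fun (history H)"
  unfolding history_def by (intro definability definable_fun_subst2[OF H])

lemma class_fun_course_value: "class_fun (\<lambda>n. H n (history H n))"
  by (intro definable_fun_subst2[OF H] definability class_fun_history)

lemma history_suc: "n \<epsilon> omega \<Longrightarrow> p \<epsilon> history H (suc n) \<longleftrightarrow>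
    p \<epsilon> history H n \<or> p = opair n (H n (history H n))"
  unfolding history_def
  by (subst omega_rec_suc) (intro definability definable_fun_subst2[OF H], simp_all)

lemma history_eq_lam: "n \<epsilon> omega \<Longrightarrow> history H n = lam n (\<lambda>k. H k (history H k))"
proof (induction n rule: omega_induct)
  case definable
  show ?case
    by (intro definability definable_fun_subst1[OF class_fun_history]
        definable_fun_subst1[OF class_fun_course_value])
next
  case empty
  have "history H empty = empty" unfolding history_def
    by (rule omega_rec_empty) (intro definability definable_fun_subst2[OF H])
  then show ?case by (intro set_eqI) (simp add: mem_lam[OF class_fun_course_value])
next
  case (suc n)
  show ?case
  proof (rule set_eqI)
    fix p
    have "p \<epsilon> history H n \<longleftrightarrow> (\<exists>k. k \<epsilon> n \<and> p = opair k (H k (history H k)))"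
      unfolding suc.IH by (rule mem_lam[OF class_fun_course_value])
    then show "p \<epsilon> history H (suc n) \<longleftrightarrow> p \<epsilon> lam (suc n) (\<lambda>k. H k (history H k))"
      unfolding mem_lam[OF class_fun_course_value] history_suc[OF suc.hyps] suc_iff by blast
  qed
qed

lemma maps_history: "n \<epsilon> omega \<Longrightarrow> maps (history H n) n A"
proof (induction n rule: omega_induct)
  case definable
  show ?case by (intro definability definable_fun_subst1[OF class_fun_history])
next
  case empty
  show ?case unfolding history_eq_lam[OF omega_empty]
    by (rule maps_lam[OF class_fun_course_value]) simp
next
  case (suc n)
  have "H k (history H k) \<epsilon> A" if "k \<epsilon> suc n" for k
  proof (cases "k = n")
    case False
    then have k: "k \<epsilon> n" using that by simp
    have "history H n \<cdot> k = H k (history H k)"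
      unfolding history_eq_lam[OF suc.hyps] by (rule fun_val_lam[OF class_fun_course_value k])
    then show ?thesis using maps_mem[OF suc.IH k] by simp
  qed (use H_mem suc in simp)
  then have "maps (lam (suc n) (\<lambda>k. H k (history H k))) (suc n) A"
    by (rule maps_lam[OF class_fun_course_value])
  then show ?case using history_eq_lam[of "suc n"] suc.hyps by simp
qed

lemma restr_course_rec: "n \<epsilon> omega \<Longrightarrow> restr (course_rec H) n = history H n"
  by (rule set_eqI)
     (auto simp: restr_iff course_rec_def mem_lam[OF class_fun_course_value] history_eq_lam
        omega_mem)

lemma course_rec_eq: "n \<epsilon> omega \<Longrightarrow> course_rec H \<cdot> n = H n (restr (course_rec H) n)"
  by (subst (1) course_rec_def) (simp add: restr_course_rec fun_val_lam[OF class_fun_course_value])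

lemma maps_restr_course_rec: "n \<epsilon> omega \<Longrightarrow> maps (restr (course_rec H) n) n A"
  by (simp add: restr_course_rec maps_history)

lemma maps_course_rec: "maps (course_rec H) omega A"
  unfolding course_rec_def
  by (rule maps_lam[OF class_fun_course_value]) (intro H_mem maps_history)

end

definition positions :: "('a \<Rightarrow> bool) \<Rightarrow> 'a \<Rightarrow> 'a" where
  "positions P A = (SET s. \<exists>n. n \<epsilon> omega \<and> P n \<and> maps s n A)"

lemma mem_positions:
  assumes P: "class_pred P" and "n \<epsilon> omega" "P n" "maps s n A" shows "s \<epsilon> positions P A"
  unfolding positions_def
proof (subst mem_SET_separation[where a = "power_set (product omega A)"])
  show "class_pred (\<lambda>s. \<exists>n. n \<epsilon> omega \<and> P n \<and> maps s n A)"
    by (intro definability definable_pred_subst1[OF P])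
  show "s \<epsilon> power_set (product omega A)" if "\<exists>n. n \<epsilon> omega \<and> P n \<and> maps s n A" for s
    using that maps_subset_product[of s _ A] omega_mem by (fastforce simp: subset_def product_iff)
  show "\<exists>n. n \<epsilon> omega \<and> P n \<and> maps s n A" using assms by blast
qed

text \<open>The play in which the strategy \<open>\<sigma>\<close> makes the moves at the positions satisfying \<open>P\<close>, and the
  terms of \<open>y\<close> are the other player's moves.\<close>

definition play :: "('a \<Rightarrow> bool) \<Rightarrow> 'a \<Rightarrow> 'a \<Rightarrow> 'a" where
  "play P \<sigma> y = course_rec (\<lambda>n g. if P n then \<sigma> \<cdot> g else y \<cdot> half n)"

lemma definable_play:
  assumes "class_pred P" "definable_fun y" shows "definable_fun (\<lambda>s. play P \<sigma> (y s))"
proof (rule definable_fun_subst1[OF _ assms(2)])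
  show "class_fun (play P \<sigma>)" unfolding play_def course_rec_def history_def
    by (intro definability definable_pred_subst1[OF assms(1)])
qed

lemma play:
  assumes P: "class_pred P" and \<sigma>: "maps \<sigma> (positions P omega) omega" and y: "y \<epsilon> reals"
  shows "maps (play P \<sigma> y) omega omega"
    and "n \<epsilon> omega \<Longrightarrow> P n \<Longrightarrow> play P \<sigma> y \<cdot> n = \<sigma> \<cdot> restr (play P \<sigma> y) n"
    and "n \<epsilon> omega \<Longrightarrow> P n \<Longrightarrow> app (play P \<sigma> y) n = app \<sigma> (restr (play P \<sigma> y) n)"
    and "n \<epsilon> omega \<Longrightarrow> \<not> P n \<Longrightarrow> play P \<sigma> y \<cdot> n = y \<cdot> half n"
proof -
  let ?H = "\<lambda>n g. if P n then \<sigma> \<cdot> g else y \<cdot> half n"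
  have H: "class_fun2 ?H" by (intro definability definable_pred_subst1[OF P])
  have H_mem: "?H n g \<epsilon> omega" if "n \<epsilon> omega" "maps g n omega" for n g
    using mem_positions[OF P] maps_mem[OF \<sigma>] that maps_mem[OF y[unfolded reals_iff]] half_omega
    by simp
  show maps: "maps (play P \<sigma> y) omega omega"
    unfolding play_def by (rule maps_course_rec[OF H H_mem])
  have play_eq: "play P \<sigma> y \<cdot> n = ?H n (restr (play P \<sigma> y) n)" if "n \<epsilon> omega" for n
    unfolding play_def by (rule course_rec_eq[OF H H_mem that])
  show play_\<sigma>: "play P \<sigma> y \<cdot> n = \<sigma> \<cdot> restr (play P \<sigma> y) n" if "n \<epsilon> omega" "P n" for n
    using play_eq that by simp
  show "play P \<sigma> y \<cdot> n = y \<cdot> half n" if "n \<epsilon> omega" "\<not> P n" for n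
    using play_eq that by simp
  have "maps (restr (play P \<sigma> y) n) n omega" if "n \<epsilon> omega" for n
    unfolding play_def by (rule maps_restr_course_rec[OF H H_mem that])
  then show "app (play P \<sigma> y) n = app \<sigma> (restr (play P \<sigma> y) n)" if "n \<epsilon> omega" "P n" for n
    using that maps_app[OF maps] maps_app[OF \<sigma>] mem_positions[OF P] play_\<sigma> by simp
qed

definition odd_part :: "'a \<Rightarrow> 'a" where
  "odd_part f = lam omega (\<lambda>k. f \<cdot> suc (dbl k))"

lemma definable_odd_part [definability]:
  "definable_fun t \<Longrightarrow> definable_fun (\<lambda>s. odd_part (t s))"
  by (rule definable_fun_subst1) (unfold odd_part_def, intro definability)

lemma odd_part_val: "k \<epsilon> omega \<Longrightarrow> odd_part f \<cdot> k = f \<cdot> suc (dbl k)"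
  unfolding odd_part_def by (rule fun_val_lam) (intro definability)

lemma odd_part_reals: "f \<epsilon> reals \<Longrightarrow> odd_part f \<epsilon> reals"
  unfolding odd_part_def reals_iff by (rule maps_lam) (intro definability, simp add: maps_mem)

lemma I_wins_plays:
  assumes "I_wins omega Z"
  obtains n where "n \<epsilon> omega" "\<And>y. y \<epsilon> reals \<Longrightarrow> \<exists>f. f \<epsilon> Z \<and> f \<cdot> empty = n \<and> odd_part f = y"
proof -
  obtain \<sigma> where \<sigma>: "maps \<sigma> (positions even_nat omega) omega"
    and win: "\<And>f. maps f omega omega \<Longrightarrow>
      (\<forall>n. n \<epsilon> omega \<longrightarrow> even_nat n \<longrightarrow> app f n = app \<sigma> (restr f n)) \<Longrightarrow> f \<epsilon> Z"
    using assms unfolding I_wins_def even_positions_def positions_def by blast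
  have even: "class_pred even_nat" by (intro definability)
  have "\<exists>f. f \<epsilon> Z \<and> f \<cdot> empty = \<sigma> \<cdot> empty \<and> odd_part f = y" if y: "y \<epsilon> reals" for y
  proof -
    let ?f = "play even_nat \<sigma> y"
    note f = play[OF even \<sigma> y]
    have "?f \<epsilon> Z" using win f(1,3) by blast
    moreover have "?f \<cdot> empty = \<sigma> \<cdot> empty"
      using f(2)[OF omega_empty even_nat_empty] restr_empty by simp
    moreover have "odd_part ?f = y"
    proof (rule fun_on_eqI)
      show "fun_on (odd_part ?f) omega" "fun_on y omega"
        using odd_part_reals f(1) y maps_fun_on unfolding reals_iff by blast+
      show "odd_part ?f \<cdot> k = y \<cdot> k" if "k \<epsilon> omega" for k
        using f(4)[of "suc (dbl k)"] not_even_nat_suc_dbl[OF that] odd_part_val[OF that] that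
        by simp
    qed
    ultimately show ?thesis by blast
  qed
  moreover have "maps empty empty omega" unfolding maps_iff fun_on_def by simp
  then have "\<sigma> \<cdot> empty \<epsilon> omega"
    by (intro maps_mem[OF \<sigma>] mem_positions[OF even omega_empty even_nat_empty])
  ultimately show ?thesis using that by blast
qed

lemma II_wins_plays:
  assumes "II_wins omega Z"
  obtains F where "class_fun F" "\<And>n. n \<epsilon> omega \<Longrightarrow> F n \<epsilon> reals \<and> \<not> F n \<epsilon> Z \<and> F n \<cdot> empty = n"
proof -
  let ?odd = "\<lambda>n. \<not> even_nat n"
  obtain \<tau> where \<tau>: "maps \<tau> (positions ?odd omega) omega"
    and win: "\<And>f. maps f omega omega \<Longrightarrow>
      (\<forall>n. n \<epsilon> omega \<longrightarrow> \<not> even_nat n \<longrightarrow> app f n = app \<tau> (restr f n)) \<Longrightarrow> \<not> f \<epsilon> Z"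
    using assms unfolding II_wins_def odd_positions_def positions_def by blast
  have odd: "class_pred ?odd" by (intro definability)
  let ?F = "\<lambda>n. play ?odd \<tau> (lam omega (\<lambda>_. n))"
  have plays: "?F n \<epsilon> reals \<and> \<not> ?F n \<epsilon> Z \<and> ?F n \<cdot> empty = n" if n: "n \<epsilon> omega" for n
  proof (intro conjI)
    note f = play[OF odd \<tau> constant_real[OF n]]
    show "?F n \<epsilon> reals" using f(1) by (simp add: reals_iff)
    show "\<not> ?F n \<epsilon> Z" using win f(1,3) by blast
    have "lam omega (\<lambda>_. n) \<cdot> half empty = n"
      by (rule fun_val_lam) (intro definability, intro half_omega omega_empty)
    then show "?F n \<cdot> empty = n" using f(4)[OF omega_empty] even_nat_empty by simp
  qed
  have "class_fun ?F" by (intro definable_play odd definability)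
  then show ?thesis by (rule that[OF _ plays])
qed

text \<open>Player I names \<open>n\<close> with the first move and player II must build an element of \<open>A n\<close>. Player I
  cannot win, and a winning strategy of player II yields a choice function.\<close>

lemma AD_imp_countable_choice:
  assumes AD shows countable_choice_reals
  unfolding countable_choice_reals_def
proof (intro allI impI)
  fix A assume A: "\<forall>n. n \<epsilon> omega \<longrightarrow> (\<exists>x. x \<epsilon> reals \<and> x \<epsilon> A \<cdot> n)"
  define Z where "Z = sep reals (\<lambda>f. \<not> odd_part f \<epsilon> A \<cdot> (f \<cdot> empty))"
  have Z: "f \<epsilon> Z \<longleftrightarrow> f \<epsilon> reals \<and> \<not> odd_part f \<epsilon> A \<cdot> (f \<cdot> empty)" for f
    unfolding Z_def by (rule sep_iff) (intro definability)
  then have "determined omega Z" using \<open>AD\<close> unfolding AD_def subset_def by blast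
  then consider (I) "I_wins omega Z" | (II) "II_wins omega Z" unfolding determined_def by blast
  then show "\<exists>C. \<forall>n. n \<epsilon> omega \<longrightarrow> C \<cdot> n \<epsilon> reals \<and> C \<cdot> n \<epsilon> A \<cdot> n"
  proof cases
    case I
    then obtain n where n: "n \<epsilon> omega"
      and plays: "\<And>y. y \<epsilon> reals \<Longrightarrow> \<exists>f. f \<epsilon> Z \<and> f \<cdot> empty = n \<and> odd_part f = y"
      by (rule I_wins_plays) blast
    obtain y where "y \<epsilon> reals" "y \<epsilon> A \<cdot> n" using A n by blast
    then show ?thesis using plays Z by blast
  next
    case II
    then obtain F where F: "class_fun F"
      "\<And>n. n \<epsilon> omega \<Longrightarrow> F n \<epsilon> reals \<and> \<not> F n \<epsilon> Z \<and> F n \<cdot> empty = n"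
      by (rule II_wins_plays) blast
    have "odd_part (F n) \<epsilon> reals \<and> odd_part (F n) \<epsilon> A \<cdot> n" if "n \<epsilon> omega" for n
      using F(2)[OF that] Z odd_part_reals by auto
    moreover have "class_fun (\<lambda>n. odd_part (F n))" by (intro definability F(1))
    ultimately show ?thesis
      using fun_val_lam[of "\<lambda>n. odd_part (F n)"]
      by (intro exI[of _ "lam omega (\<lambda>n. odd_part (F n))"]) simp
  qed
qed

section \<open>Splitting a set into quotients of the reals\<close>

lemma countable_increasing_maps:
  assumes "f \<epsilon> countable_increasing" obtains a where "a \<epsilon> omega1" "maps f a omega1"
proof -
  have order: "(\<forall>b c. b \<epsilon> c \<longrightarrow> c \<epsilon> a \<longrightarrow> app f b \<epsilon> app f c) \<longleftrightarrow>
      (\<forall>b c. b \<epsilon> c \<longrightarrow> c \<epsilon> a \<longrightarrow> f \<cdot> b \<epsilon> f \<cdot> c)" if "a \<epsilon> omega1" "maps f a omega1" for f a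
  proof -
    have "b \<epsilon> a" if "b \<epsilon> c" "c \<epsilon> a" for b c
      using ordinal_trans[OF ordinal_of_omega1[OF \<open>a \<epsilon> omega1\<close>] that] .
    then show ?thesis using maps_app[OF that(2)] by auto
  qed
  have "is_set (\<lambda>f. \<exists>a. a \<epsilon> omega1 \<and> maps f a omega1 \<and>
      (\<forall>b c. b \<epsilon> c \<longrightarrow> c \<epsilon> a \<longrightarrow> f \<cdot> b \<epsilon> f \<cdot> c))"
  proof (rule is_set_separation[where a = "power_set (product omega1 omega1)"])
    fix f assume "\<exists>a. a \<epsilon> omega1 \<and> maps f a omega1 \<and> (\<forall>b c. b \<epsilon> c \<longrightarrow> c \<epsilon> a \<longrightarrow> f \<cdot> b \<epsilon> f \<cdot> c)"
    then obtain a where a: "a \<epsilon> omega1" "maps f a omega1" by blast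
    show "f \<epsilon> power_set (product omega1 omega1)"
      using maps_subset_product[OF a(2)] ordinal_trans[OF ordinal_omega1 _ a(1)]
      by (auto simp: subset_def product_iff)
  qed (intro definability)
  then have "is_set (\<lambda>f. \<exists>a. a \<epsilon> omega1 \<and> maps f a omega1 \<and>
      (\<forall>b c. b \<epsilon> c \<longrightarrow> c \<epsilon> a \<longrightarrow> app f b \<epsilon> app f c))"
    by (rule is_set_cong) (use order in blast)
  then show ?thesis using assms that unfolding countable_increasing_def by (auto simp: mem_SET)
qed

lemma countable_increasing_bounded:
  assumes countable_choice_reals "f \<epsilon> countable_increasing" shows "bounded f"
proof -
  obtain a where a: "a \<epsilon> omega1" "maps f a omega1"
    using assms(2) by (rule countable_increasing_maps)
  have "class_fun (\<lambda>b. suc (f \<cdot> b))" by (intro definability)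
  moreover have "suc (f \<cdot> b) \<epsilon> omega1" if "b \<epsilon> a" for b using omega1_suc maps_mem[OF a(2) that] .
  ultimately obtain u where u: "u \<epsilon> omega1" "\<And>b. b \<epsilon> a \<Longrightarrow> subset (suc (f \<cdot> b)) u"
    by (rule omega1_regular[OF assms(1) a(1)]) blast+
  obtain d where d: "d \<epsilon> omega1" "subset a d" "subset u d" using omega1_upper_bound[OF a(1) u(1)] .
  have "f \<cdot> b \<epsilon> d" if "b \<epsilon> a" for b using u(2)[OF that] d(3) unfolding subset_def by simp
  then have "subset f (product d d)"
    using d(2) mem_fun_iff[OF maps_fun_on[OF a(2)]] by (auto simp: subset_def)
  then show ?thesis unfolding bounded_def using d(1) by blast
qed

lemma reals_quotient_iff:
  "c \<epsilon> reals_quotient E \<longleftrightarrow> (\<exists>x. x \<epsilon> reals \<and> c = (SET y. opair x y \<epsilon> E))"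
  unfolding reals_quotient_def by (rule mem_SET) (intro is_set_replacement definability)

lemma definable_reals_quotient [definability]:
  "definable_fun t \<Longrightarrow> definable_fun (\<lambda>s. reals_quotient (t s))"
  by (rule definable_fun_subst1) (unfold reals_quotient_def, intro definability)

lemma quotients_disjoint_union_iff:
  assumes "fun_on E omega1"
  shows "p \<epsilon> quotients_disjoint_union E \<longleftrightarrow>
    (\<exists>a c. a \<epsilon> omega1 \<and> c \<epsilon> reals_quotient (app E a) \<and> p = opair a c)"
proof -
  have "is_set (\<lambda>p. \<exists>a c. a \<epsilon> omega1 \<and> c \<epsilon> reals_quotient (E \<cdot> a) \<and> p = opair a c)"
    by (rule is_set_Sigma) (intro definability)
  then have "is_set (\<lambda>p. \<exists>a c. a \<epsilon> omega1 \<and> c \<epsilon> reals_quotient (app E a) \<and> p = opair a c)"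
    by (rule is_set_cong) (use app_eq_fun_val[OF assms] in auto)
  then show ?thesis unfolding quotients_disjoint_union_def by (rule mem_SET)
qed

definition fiber :: "'a \<Rightarrow> ('a \<Rightarrow> 'a) \<Rightarrow> 'a \<Rightarrow> 'a" where
  "fiber A F f = sep A (\<lambda>x. F x = f)"

lemma fiber_iff: "class_fun F \<Longrightarrow> x \<epsilon> fiber A F f \<longleftrightarrow> x \<epsilon> A \<and> F x = f"
  unfolding fiber_def by (rule sep_iff) (intro definability)

lemma fiber_inject: "class_fun F \<Longrightarrow> x \<epsilon> A \<Longrightarrow> fiber A F (F x) = fiber A F f \<longleftrightarrow> F x = f"
  using fiber_iff[of F x A] by metis

definition kernel :: "('a \<Rightarrow> 'a) \<Rightarrow> 'a" where
  "kernel F = sep (product reals reals) (\<lambda>p. F (pfst p) = F (psnd p))"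

context
  fixes F assumes F: "class_fun F"
begin

lemma kernel_iff: "p \<epsilon> kernel F \<longleftrightarrow> p \<epsilon> product reals reals \<and> F (pfst p) = F (psnd p)"
  unfolding kernel_def by (rule sep_iff) (intro definability definable_fun_subst1[OF F])

lemma equivalence_on_reals_kernel: "equivalence_on_reals (kernel F)"
  unfolding equivalence_on_reals_def by (auto simp: kernel_iff product_iff)

lemma reals_quotient_kernel_iff:
  "c \<epsilon> reals_quotient (kernel F) \<longleftrightarrow> (\<exists>x. x \<epsilon> reals \<and> c = fiber reals F (F x))"
proof -
  have "(SET y. opair x y \<epsilon> kernel F) = fiber reals F (F x)" if "x \<epsilon> reals" for x
    by (rule SET_eq) (use that in \<open>auto simp: kernel_iff fiber_iff[OF F]\<close>)
  then show ?thesis unfolding reals_quotient_iff by auto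
qed

lemma in_bijection_quotient_kernel:
  assumes P: "\<And>f. f \<epsilon> P \<longleftrightarrow> (\<exists>x. x \<epsilon> reals \<and> F x = f)"
  shows "in_bijection P (reals_quotient (kernel F))"
proof (rule in_bijectionI)
  show "class_fun (fiber reals F)"
    unfolding fiber_def by (intro definability definable_fun_subst1[OF F])
qed (use P fiber_inject[OF F] in \<open>auto simp: reals_quotient_kernel_iff\<close>)

end

lemma in_bijection_kernel_quotients:
  assumes F: "class_fun2 F" and \<pi>: "class_fun \<pi>"
    and F_mem: "\<And>a x. a \<epsilon> omega1 \<Longrightarrow> x \<epsilon> reals \<Longrightarrow> F a x \<epsilon> X \<and> \<pi> (F a x) = a"
    and onto: "\<And>f. f \<epsilon> X \<Longrightarrow> \<pi> f \<epsilon> omega1 \<and> (\<exists>x. x \<epsilon> reals \<and> F (\<pi> f) x = f)"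
  shows "in_bijection X (quotients_disjoint_union (lam omega1 (\<lambda>a. kernel (F a))))"
proof (rule in_bijectionI)
  note [definability] = definable_fun_subst2[OF F] definable_fun_subst1[OF \<pi>]
  have kernels: "class_fun (\<lambda>a. kernel (F a))" unfolding kernel_def by (intro definability)
  note union_iff = quotients_disjoint_union_iff[OF fun_on_lam[OF kernels]]
  have Fa: "class_fun (F a)" for a by (intro definability)
  let ?t = "\<lambda>f. opair (\<pi> f) (fiber reals (F (\<pi> f)) f)"
  show "class_fun ?t" unfolding fiber_def by (intro definability)
  show "?t f \<epsilon> quotients_disjoint_union (lam omega1 (\<lambda>a. kernel (F a)))" if "f \<epsilon> X" for f
    using onto[OF that] app_lam[OF kernels] unfolding union_iff
    by (auto simp: reals_quotient_kernel_iff[OF Fa])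
  show "f = g" if fg: "f \<epsilon> X" "g \<epsilon> X" "?t f = ?t g" for f g
  proof -
    obtain x where "x \<epsilon> reals" "F (\<pi> f) x = f" using onto[OF fg(1)] by blast
    then show ?thesis using fiber_inject[OF Fa, of x reals "\<pi> f" g] fg(3) by auto
  qed
  fix p assume "p \<epsilon> quotients_disjoint_union (lam omega1 (\<lambda>a. kernel (F a)))"
  then obtain a x where "a \<epsilon> omega1" "x \<epsilon> reals" "p = opair a (fiber reals (F a) (F a x))"
    using app_lam[OF kernels] unfolding union_iff by (auto simp: reals_quotient_kernel_iff[OF Fa])
  then show "\<exists>f. f \<epsilon> X \<and> ?t f = p"
    using F_mem[of a x] by (intro exI[of _ "F a x"]) simp
qed

text \<open>All reals that do not code an element of the piece \<open>a\<close> of \<open>X\<close> are made to code the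
  distinguished element \<open>j a\<close> of that piece.\<close>

lemma partition_into_quotients:
  assumes X: "\<And>f. f \<epsilon> X \<Longrightarrow> bounded f"
    and \<pi>: "class_fun \<pi>" "\<And>f. f \<epsilon> X \<Longrightarrow> \<pi> f \<epsilon> omega1"
    and j: "class_fun j" "\<And>a. a \<epsilon> omega1 \<Longrightarrow> j a \<epsilon> X \<and> \<pi> (j a) = a"
  obtains E where "fun_on E omega1" "in_bijection X (quotients_disjoint_union E)"
    "\<And>a. a \<epsilon> omega1 \<Longrightarrow> equivalence_on_reals (app E a)"
    "\<And>a. a \<epsilon> omega1 \<Longrightarrow> in_bijection (fiber X \<pi> a) (reals_quotient (app E a))"
proof -
  obtain K where K: "class_fun K" "\<And>f. bounded f \<Longrightarrow> \<exists>x. x \<epsilon> reals \<and> K x = f"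
    by (rule reals_onto_bounded) blast
  note [definability] = definable_fun_subst1[OF K(1)] definable_fun_subst1[OF \<pi>(1)]
    definable_fun_subst1[OF j(1)]
  define F where "F a x = (if K x \<epsilon> X \<and> \<pi> (K x) = a then K x else j a)" for a x
  have F: "class_fun2 F" unfolding F_def by (intro definability)
  have F_mem: "F a x \<epsilon> X \<and> \<pi> (F a x) = a" if "a \<epsilon> omega1" for a x
    using j(2)[OF that] unfolding F_def by auto
  have F_onto: "\<exists>x. x \<epsilon> reals \<and> F (\<pi> f) x = f" if "f \<epsilon> X" for f
    using K(2)[OF X[OF that]] that unfolding F_def by auto
  have Fa: "class_fun (F a)" for a by (intro definable_fun_subst2[OF F] definability)
  have kernels: "class_fun (\<lambda>a. kernel (F a))"
    unfolding kernel_def by (intro definability definable_fun_subst2[OF F])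
  show ?thesis
  proof (rule that)
    show "fun_on (lam omega1 (\<lambda>a. kernel (F a))) omega1" by (rule fun_on_lam[OF kernels])
    show "in_bijection X (quotients_disjoint_union (lam omega1 (\<lambda>a. kernel (F a))))"
      by (rule in_bijection_kernel_quotients[OF F \<pi>(1)]) (use F_mem F_onto \<pi>(2) in blast)+
    fix a assume a: "a \<epsilon> omega1"
    show "equivalence_on_reals (app (lam omega1 (\<lambda>a. kernel (F a))) a)"
      unfolding app_lam[OF kernels a] by (rule equivalence_on_reals_kernel[OF Fa])
    show "in_bijection (fiber X \<pi> a)
        (reals_quotient (app (lam omega1 (\<lambda>a. kernel (F a))) a))"
      unfolding app_lam[OF kernels a]
      by (intro in_bijection_quotient_kernel[OF Fa])
         (use F_mem[OF a] F_onto fiber_iff[OF \<pi>(1)] in auto)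
  qed
qed

definition extend_by_bound :: "('a \<Rightarrow> 'a) \<Rightarrow> 'a \<Rightarrow> 'a \<Rightarrow> 'a \<Rightarrow> 'a" where
  "extend_by_bound d h S f = (if \<exists>s. s \<epsilon> S \<and> h \<cdot> s = f then d (fun_inv h S f) else bound f)"

context
  fixes X S h d
  assumes X: "\<And>f. f \<epsilon> X \<Longrightarrow> bounded f" and h: "inj_from_to h S X" and d: "class_fun d"
begin

lemma class_fun_extend_by_bound: "class_fun (extend_by_bound d h S)"
  unfolding extend_by_bound_def by (intro definability definable_fun_subst1[OF d])

lemma extend_by_bound_image: "s \<epsilon> S \<Longrightarrow> extend_by_bound d h S (h \<cdot> s) = d s"
  using fun_inv_fun_val[OF h] unfolding extend_by_bound_def by auto

lemma extend_by_bound_omega1: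
  assumes "\<And>s. s \<epsilon> S \<Longrightarrow> d s \<epsilon> omega1" "f \<epsilon> X" shows "extend_by_bound d h S f \<epsilon> omega1"
  using assms(1) bound(1)[OF X[OF assms(2)]] fun_inv_fun_val[OF h]
  unfolding extend_by_bound_def by auto

lemma fiber_injects_piece:
  "injects (fiber S d a) (fiber X (extend_by_bound d h S) a)"
proof (rule injectsI)
  show "class_fun ((\<cdot>) h)" by (intro definability)
qed (auto simp: fiber_iff[OF d] fiber_iff[OF class_fun_extend_by_bound] extend_by_bound_image
    inj_from_to_mem[OF h] inj_from_to_eq_iff[OF h])

lemma piece_injects_disjoint_sum:
  "injects (fiber X (extend_by_bound d h S) a)
     (disjoint_sum (fiber S d a) (power_set (product a a)))"
proof (rule injectsI)
  note piece_iff = fiber_iff[OF class_fun_extend_by_bound]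
  let ?t = "\<lambda>f. if \<exists>s. s \<epsilon> S \<and> h \<cdot> s = f then opair empty (fun_inv h S f) else opair (suc empty) f"
  show "class_fun ?t" by (intro definability)
  show "?t f \<epsilon> disjoint_sum (fiber S d a) (power_set (product a a))"
    if "f \<epsilon> fiber X (extend_by_bound d h S) a" for f
  proof (cases "\<exists>s. s \<epsilon> S \<and> h \<cdot> s = f")
    case True
    then obtain s where s: "s \<epsilon> S" "f = h \<cdot> s" by blast
    then have "d s = a" using that extend_by_bound_image piece_iff by simp
    then show ?thesis using True s fun_inv_fun_val[OF h s(1)] by (simp add: fiber_iff[OF d])
  next
    case False
    then have "f \<epsilon> X" "bound f = a"
      using that[unfolded piece_iff] unfolding extend_by_bound_def by auto
    then show ?thesis using False bound(2)[OF X] by auto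
  qed
  show "f = g" if "?t f = ?t g" for f g
    using that fun_inv_fun_val[OF h] by (auto split: if_splits)
qed

end

lemma quotients_along_injection:
  assumes X: "\<And>f. f \<epsilon> X \<Longrightarrow> bounded f" and h: "inj_from_to h S X"
    and d: "class_fun d" "\<And>s. s \<epsilon> S \<Longrightarrow> d s \<epsilon> omega1"
    and \<sigma>: "class_fun \<sigma>" "\<And>a. a \<epsilon> omega1 \<Longrightarrow> \<sigma> a \<epsilon> S \<and> d (\<sigma> a) = a"
  obtains E where "fun_on E omega1" "in_bijection X (quotients_disjoint_union E)"
    "\<And>a. a \<epsilon> omega1 \<Longrightarrow> equivalence_on_reals (app E a)"
    "\<And>a. a \<epsilon> omega1 \<Longrightarrow> injects (fiber S d a) (reals_quotient (app E a))"
    "\<And>a. a \<epsilon> omega1 \<Longrightarrow> injects (reals_quotient (app E a))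
      (disjoint_sum (fiber S d a) (power_set (product a a)))"
proof -
  let ?\<pi> = "extend_by_bound d h S"
  have j: "class_fun (\<lambda>a. h \<cdot> \<sigma> a)" by (intro definability definable_fun_subst1[OF \<sigma>(1)])
  have j_mem: "h \<cdot> \<sigma> a \<epsilon> X \<and> ?\<pi> (h \<cdot> \<sigma> a) = a" if "a \<epsilon> omega1" for a
    using \<sigma>(2)[OF that] inj_from_to_mem[OF h] extend_by_bound_image[OF X h d(1)] by simp
  obtain E where E: "fun_on E omega1" "in_bijection X (quotients_disjoint_union E)"
    "\<And>a. a \<epsilon> omega1 \<Longrightarrow> equivalence_on_reals (app E a)"
    and piece: "\<And>a. a \<epsilon> omega1 \<Longrightarrow> in_bijection (fiber X ?\<pi> a) (reals_quotient (app E a))"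
    by (rule partition_into_quotients[OF X class_fun_extend_by_bound[OF X h d(1)]
          extend_by_bound_omega1[OF X h d(1,2)] j j_mem]) blast+
  show ?thesis
  proof (rule that[OF E])
    fix a assume "a \<epsilon> omega1"
    note piece = piece[OF this, unfolded in_bijection_iff_injects]
    show "injects (fiber S d a) (reals_quotient (app E a))"
      by (rule injects_trans[OF fiber_injects_piece[OF X h d(1)] conjunct1[OF piece]])
    show "injects (reals_quotient (app E a))
        (disjoint_sum (fiber S d a) (power_set (product a a)))"
      by (rule injects_trans[OF conjunct2[OF piece] piece_injects_disjoint_sum[OF X h d(1)]])
  qed
qed

definition sum_of_quotients :: "('a \<Rightarrow> bool) \<Rightarrow> 'a \<Rightarrow> bool" where
  "sum_of_quotients R X \<longleftrightarrow> (\<exists>E. fun_on E omega1 \<and>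
     (\<forall>a. a \<epsilon> omega1 \<longrightarrow> R (app E a)) \<and> in_bijection X (quotients_disjoint_union E))"

lemma weakly_smooth_quotients:
  assumes bounded: "\<And>f. f \<epsilon> X \<Longrightarrow> bounded f" and inj: "injects omega1 X"
  shows "sum_of_quotients weakly_smooth X"
proof -
  obtain h where h: "inj_from_to h omega1 X" using inj by (rule injectsE)
  have id: "class_fun (\<lambda>a. a)" by (intro definability)
  obtain E where E: "fun_on E omega1" "in_bijection X (quotients_disjoint_union E)"
    and eq: "\<And>a. a \<epsilon> omega1 \<Longrightarrow> equivalence_on_reals (app E a)"
    and quot: "\<And>a. a \<epsilon> omega1 \<Longrightarrow> injects (reals_quotient (app E a))
      (disjoint_sum (fiber omega1 (\<lambda>s. s) a) (power_set (product a a)))"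
    by (rule quotients_along_injection[OF bounded h id _ id]) blast+
  have "weakly_smooth (app E a)" if a: "a \<epsilon> omega1" for a
  proof -
    have "subset (fiber omega1 (\<lambda>s. s) a) (suc a)" by (simp add: subset_def fiber_iff[OF id])
    then have "countable (fiber omega1 (\<lambda>s. s) a)"
      by (rule countable_subset[OF _ countable_of_omega1[OF omega1_suc[OF a]]])
    then have "injects (fiber omega1 (\<lambda>s. s) a) reals"
      unfolding countable_def by (rule injects_trans[OF _ omega_injects_reals])
    then show ?thesis unfolding weakly_smooth_def
      using eq[OF a] injects_trans[OF quot[OF a]]
        disjoint_sum_injects_reals[OF _ power_set_bounded_injects_reals[OF a]] by blast
  qed
  then show ?thesis using E unfolding sum_of_quotients_def by blast
qed

lemma reals_partition:
  obtains r where "class_fun r" "\<And>z. z \<epsilon> reals \<Longrightarrow> r z \<epsilon> omega1"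
    "\<And>a. a \<epsilon> omega1 \<Longrightarrow> injects reals (fiber reals r a)"
proof -
  obtain K where K: "class_fun K" "\<And>a. a \<epsilon> omega1 \<Longrightarrow> \<exists>y. y \<epsilon> reals \<and> K y = a"
    by (rule reals_onto_omega1) blast
  note [definability] = definable_fun_subst1[OF K(1)]
  have "injects (product reals reals) reals"
    by (intro product_injects_reals injects_refl)
  then obtain m where m: "inj_from_to m (product reals reals) reals" by (rule injectsE)
  define v where "v z = K (psnd (fun_inv m (product reals reals) z))" for z
  define r where "r z = (if v z \<epsilon> omega1 then v z else empty)" for z
  have r: "class_fun r" unfolding r_def v_def by (intro definability)
  have "injects reals (fiber reals r a)" if a: "a \<epsilon> omega1" for a
  proof -
    obtain y where y: "y \<epsilon> reals" "K y = a" using K(2)[OF a] by blast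
    show ?thesis
    proof (rule injectsI)
      show "class_fun (\<lambda>x. m \<cdot> opair x y)" by (intro definability)
      fix x assume "x \<epsilon> reals"
      then have "m \<cdot> opair x y \<epsilon> reals" "r (m \<cdot> opair x y) = a"
        using y a inj_from_to_mem[OF m] fun_inv_fun_val[OF m] unfolding r_def v_def by simp_all
      then show "m \<cdot> opair x y \<epsilon> fiber reals r a" using fiber_iff[OF r] by blast
    qed (use y in \<open>simp add: inj_from_to_eq_iff[OF m]\<close>)
  qed
  then show ?thesis using that[of r] r unfolding r_def by simp
qed

lemma disjoint_sum_partition:
  obtains d where "class_fun d" "\<And>s. s \<epsilon> disjoint_sum reals omega1 \<Longrightarrow> d s \<epsilon> omega1"
    "\<And>a. d (opair (suc empty) a) = a"
    "\<And>a. a \<epsilon> omega1 \<Longrightarrow> in_bijection (fiber (disjoint_sum reals omega1) d a) reals"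
proof -
  let ?S = "disjoint_sum reals omega1"
  obtain r where r: "class_fun r" "\<And>z. z \<epsilon> reals \<Longrightarrow> r z \<epsilon> omega1"
    "\<And>a. a \<epsilon> omega1 \<Longrightarrow> injects reals (fiber reals r a)"
    by (rule reals_partition) blast
  define d where "d p = (if pfst p = empty then r (psnd p) else psnd p)" for p
  have d: "class_fun d" unfolding d_def by (intro definability definable_fun_subst1[OF r(1)])
  have d_opair: "d (opair empty z) = r z" "d (opair (suc empty) a) = a" for z a
    unfolding d_def by simp_all
  have "in_bijection (fiber ?S d a) reals" if a: "a \<epsilon> omega1" for a
    unfolding in_bijection_iff_injects
  proof
    have "injects (suc a) reals"
      using countable_of_omega1[OF omega1_suc[OF a]] omega_injects_reals injects_trans
      unfolding countable_def by blast
    moreover have "subset (fiber ?S d a) (disjoint_sum reals (suc a))"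
      by (auto simp: subset_def fiber_iff[OF d] disjoint_sum_iff d_opair)
    ultimately show "injects (fiber ?S d a) reals"
      using injects_trans[OF subset_imp_injects disjoint_sum_injects_reals[OF injects_refl]]
      by blast
    have "injects (fiber reals r a) (fiber ?S d a)"
    proof (rule injectsI)
      show "class_fun (opair empty)" by (intro definability)
    qed (simp_all add: fiber_iff[OF d] fiber_iff[OF r(1)] d_opair)
    then show "injects reals (fiber ?S d a)" by (rule injects_trans[OF r(3)[OF a]])
  qed
  moreover have "d s \<epsilon> omega1" if "s \<epsilon> ?S" for s
    using that r(2) d_opair unfolding disjoint_sum_iff by auto
  ultimately show ?thesis using that d d_opair(2) by blast
qed

lemma smooth_quotients:
  assumes bounded: "\<And>f. f \<epsilon> X \<Longrightarrow> bounded f"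
    and inj: "injects (disjoint_sum reals omega1) X"
  shows "sum_of_quotients smooth X"
proof -
  let ?S = "disjoint_sum reals omega1"
  obtain h where h: "inj_from_to h ?S X" using inj by (rule injectsE)
  obtain d where d: "class_fun d" "\<And>s. s \<epsilon> ?S \<Longrightarrow> d s \<epsilon> omega1"
    "\<And>a. d (opair (suc empty) a) = a"
    "\<And>a. a \<epsilon> omega1 \<Longrightarrow> in_bijection (fiber ?S d a) reals"
    by (rule disjoint_sum_partition) blast
  have \<sigma>: "class_fun (opair (suc empty))" by (intro definability)
  obtain E where E: "fun_on E omega1" "in_bijection X (quotients_disjoint_union E)"
    and eq: "\<And>a. a \<epsilon> omega1 \<Longrightarrow> equivalence_on_reals (app E a)"
    and into: "\<And>a. a \<epsilon> omega1 \<Longrightarrow> injects (fiber ?S d a) (reals_quotient (app E a))"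
    and quot: "\<And>a. a \<epsilon> omega1 \<Longrightarrow> injects (reals_quotient (app E a))
      (disjoint_sum (fiber ?S d a) (power_set (product a a)))"
    by (rule quotients_along_injection[OF bounded h d(1,2) \<sigma>]) (simp_all add: d(3))
  have "smooth (app E a)" if a: "a \<epsilon> omega1" for a
  proof -
    have fib: "injects (fiber ?S d a) reals" "injects reals (fiber ?S d a)"
      using d(4)[OF a] unfolding in_bijection_iff_injects by blast+
    have "injects reals (reals_quotient (app E a))" by (rule injects_trans[OF fib(2) into[OF a]])
    moreover have "injects (reals_quotient (app E a)) reals"
      by (rule injects_trans[OF quot[OF a]
            disjoint_sum_injects_reals[OF fib(1) power_set_bounded_injects_reals[OF a]]])
    ultimately show ?thesis using eq[OF a] unfolding smooth_def in_bijection_iff_injects by blast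
  qed
  then show ?thesis using E unfolding sum_of_quotients_def by blast
qed

lemma smooth_quotients_imp_injects:
  assumes "sum_of_quotients smooth X" shows "injects (disjoint_sum reals omega1) X"
proof -
  obtain E where E: "fun_on E omega1" and smooth: "\<And>a. a \<epsilon> omega1 \<Longrightarrow> smooth (app E a)"
    and X: "in_bijection X (quotients_disjoint_union E)"
    using assms unfolding sum_of_quotients_def by blast
  have "injects reals (reals_quotient (app E empty))"
    using smooth[OF omega1_empty] unfolding smooth_def in_bijection_iff_injects by blast
  then obtain h where h: "inj_from_to h reals (reals_quotient (app E empty))" by (rule injectsE)
  define z where "z = lam omega (\<lambda>_. empty)"
  have "z \<epsilon> reals" unfolding z_def by (rule constant_real) simp
  define cls where "cls a = (SET y. opair z y \<epsilon> E \<cdot> a)" for a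
  have cls: "cls a \<epsilon> reals_quotient (app E a)" if "a \<epsilon> omega1" for a
    unfolding cls_def reals_quotient_iff app_eq_fun_val[OF E that] using \<open>z \<epsilon> reals\<close> by blast
  let ?t = "\<lambda>p. if pfst p = empty then opair empty (h \<cdot> psnd p)
    else opair (suc (psnd p)) (cls (suc (psnd p)))"
  have "injects (disjoint_sum reals omega1) (quotients_disjoint_union E)"
  proof (rule injectsI)
    show "class_fun ?t" unfolding cls_def by (intro definability)
    show "?t p \<epsilon> quotients_disjoint_union E" if "p \<epsilon> disjoint_sum reals omega1" for p
      using that inj_from_to_mem[OF h] cls omega1_suc
      unfolding disjoint_sum_iff quotients_disjoint_union_iff[OF E] by auto
    show "p = q"
      if "p \<epsilon> disjoint_sum reals omega1" "q \<epsilon> disjoint_sum reals omega1" "?t p = ?t q" for p q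
      using that inj_from_to_eq_iff[OF h] unfolding disjoint_sum_iff by auto
  qed
  then show ?thesis using X injects_trans unfolding in_bijection_iff_injects by blast
qed

lemma smooth_quotients_iff:
  "(\<And>f. f \<epsilon> X \<Longrightarrow> bounded f) \<Longrightarrow>
    sum_of_quotients smooth X \<longleftrightarrow> injects (disjoint_sum reals omega1) X"
  using smooth_quotients smooth_quotients_imp_injects by blast

end

theorem theorem6p1:
  fixes mem :: "'v \<Rightarrow> 'v \<Rightarrow> bool"
  assumes "eps_structure.ZF mem"
  shows
    "(eps_structure.AD mem \<longrightarrow>
       (\<forall>X. eps_structure.subset mem X (eps_structure.countable_increasing mem) \<longrightarrow>
          eps_structure.injects mem (eps_structure.omega1 mem) X \<longrightarrow>
          (\<exists>E. eps_structure.fun_on mem E (eps_structure.omega1 mem) \<and>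
             (\<forall>a. mem a (eps_structure.omega1 mem) \<longrightarrow>
                eps_structure.weakly_smooth mem (eps_structure.app mem E a)) \<and>
             eps_structure.in_bijection mem X (eps_structure.quotients_disjoint_union mem E))))
     \<and>
     (eps_structure.AD_plus mem \<longrightarrow> eps_structure.V_eq_L_power_reals mem \<longrightarrow>
       (\<forall>X. eps_structure.subset mem X (eps_structure.countable_increasing mem) \<longrightarrow>
          eps_structure.injects mem
            (eps_structure.disjoint_sum mem (eps_structure.reals mem) (eps_structure.omega1 mem)) X \<longrightarrow>
          (\<exists>E. eps_structure.fun_on mem E (eps_structure.omega1 mem) \<and>
             (\<forall>a. mem a (eps_structure.omega1 mem) \<longrightarrow>
                eps_structure.smooth mem (eps_structure.app mem E a)) \<and>
             eps_structure.in_bijection mem X (eps_structure.quotients_disjoint_union mem E))))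
     \<and>
     (eps_structure.AD_plus mem \<longrightarrow> eps_structure.V_eq_L_power_reals mem \<longrightarrow>
       (\<forall>X. eps_structure.subset mem X (eps_structure.countable_increasing mem) \<longrightarrow>
          ((\<exists>E. eps_structure.fun_on mem E (eps_structure.omega1 mem) \<and>
              (\<forall>a. mem a (eps_structure.omega1 mem) \<longrightarrow>
                 eps_structure.smooth mem (eps_structure.app mem E a)) \<and>
              eps_structure.in_bijection mem X (eps_structure.quotients_disjoint_union mem E))
           \<longleftrightarrow>
           eps_structure.injects mem
             (eps_structure.disjoint_sum mem (eps_structure.reals mem) (eps_structure.omega1 mem)) X)))"
proof -
  interpret zf_model mem by (rule zf_model.intro[OF assms])
  have bounded: "bounded f" if "AD \<or> AD_plus" "subset X countable_increasing" "mem f X" for X f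
    using that countable_increasing_bounded AD_imp_countable_choice DC_imp_countable_choice
    unfolding AD_plus_def subset_def by blast
  have weakly: "sum_of_quotients weakly_smooth X"
    if "AD" "subset X countable_increasing" "injects omega1 X" for X
    by (rule weakly_smooth_quotients) (use that bounded in blast)+
  have smooth_iff: "sum_of_quotients smooth X \<longleftrightarrow> injects (disjoint_sum reals omega1) X"
    if "AD_plus" "subset X countable_increasing" for X
    by (rule smooth_quotients_iff) (use that bounded in blast)
  show ?thesis
    using weakly smooth_iff unfolding sum_of_quotients_def by blast
qed

end
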